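(* Let $X$ be a compact, path-connected, triangulable space and let $R$ be a commutative unital ring. For every weight estimator $\mathbf{w}$ on $\widetilde H^*(X;R)$ and every finite sequence $s$ of homogeneous elements of $\widetilde H^*(X;R)$ with $\widehat{s}\ne0$ we have $$\Delta(X)\ \ge\ \mathrm{wct}(s;\mathbf{w}).$$
   Context: $\Delta(X)$ is the minimal number of vertices of a simplicial complex $K$ whose geometric realization is homeomorphic to $X$. Category: a subset $A\subseteq X$ is categorical in $X$ if the inclusion $A\hookrightarrow X$ is null-homotopic. For $A\subseteq X$, $\mathrm{cat}(A)$ is the minimal integer $k$ such that $A$ can be covered by $k$ open subsets of $A$, each categorical in $X$ (non-normalized convention). Category weight: for a non-zero class $u\in H^q(X;R)$, $q\ge 1$, $\mathrm{cwgt}(u)$ is the maximal integer $k$ such that $u|_A=0$ for every closed subset $A\subseteq X$ with $\mathrm{cat}(A)\le k$. Weight estimator: a function $\mathbf{w}$ assigning to every non-zero homogeneous class $u\in\widetilde H^*(X;R)$ a positive integer $\mathbf{w}(u)\le \mathrm{cwgt}(u)$. For a finite sequence $s=(u_1,\dots,u_n)$ of homogeneous classes write $\widehat s:=u_1\cdots u_n$; if $\widehat s\ne0$, put $\mathbf{w}(s):=\sum_i\mathbf{w}(u_i)$. $|u|$ denotes the degree of $u$. For the empty sequence, by convention, $\mathbf{w}(s):=0$ and $|\widehat s|:=-1$. $s'\le s$ means that $s'$ is a (possibly empty) subsequence of $s$, up to permutation. Then $$\mathrm{wct}(s;\mathbf{w}):=1+\mathbf{w}(s)+\sum_{k=1}^{\mathbf{w}(s)}\max\big\{|\widehat{s'}|\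 \big|\ s'\le s,\ \mathbf{w}(s')\le k\big\}.$$ *)

theory Defs
  imports "HOL-Homology.Homology" "HOL-Library.Multiset" "HOL-Library.Extended_Nat"
begin

section \<open>Simplicial complexes, triangulations and the number of vertices\<close>

definition abstract_simplicial_complex :: "'v set set \<Rightarrow> bool" where
  "abstract_simplicial_complex K \<longleftrightarrow>
     (\<forall>\<sigma>\<in>K. finite \<sigma> \<and> \<sigma> \<noteq> {}) \<and> (\<forall>\<sigma>\<in>K. \<forall>\<tau>. \<tau> \<subseteq> \<sigma> \<and> \<tau> \<noteq> {} \<longrightarrow> \<tau> \<in> K)"

text \<open>Points of the realization are systems of barycentric coordinates.\<close>

definition closed_simplex :: "'v set \<Rightarrow> ('v \<Rightarrow> real) set" where
  "closed_simplex \<sigma> = {t. (\<forall>v. 0 \<le> t v) \<and> (\<forall>v. v \<notin> \<sigma> \<longrightarrow> t v = 0) \<and> (\<Sum>v\<in>\<sigma>. t v) = 1}"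

text \<open>The weak topology: a set is open iff it meets every closed simplex in a set that is open
  for the Euclidean topology of that simplex. For a finite complex this is the subspace topology.\<close>

definition geometric_realization :: "'v set set \<Rightarrow> ('v \<Rightarrow> real) topology" where
  "geometric_realization K = topology (\<lambda>U. U \<subseteq> (\<Union>\<sigma>\<in>K. closed_simplex \<sigma>) \<and>
     (\<forall>\<sigma>\<in>K. openin (subtopology (powertop_real UNIV) (closed_simplex \<sigma>)) (U \<inter> closed_simplex \<sigma>)))"

lemma openin_geometric_realization:
  "openin (geometric_realization K) U \<longleftrightarrow> U \<subseteq> (\<Union>\<sigma>\<in>K. closed_simplex \<sigma>) \<and>
     (\<forall>\<sigma>\<in>K. openin (subtopology (powertop_real UNIV) (closed_simplex \<sigma>)) (U \<inter> closed_simplex \<sigma>))"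
proof -
  let ?op = "\<lambda>U. U \<subseteq> (\<Union>\<sigma>\<in>K. closed_simplex \<sigma>) \<and>
     (\<forall>\<sigma>\<in>K. openin (subtopology (powertop_real UNIV) (closed_simplex \<sigma>)) (U \<inter> closed_simplex \<sigma>))"
  have "istopology ?op"
    unfolding istopology_def
  proof (intro conjI allI impI)
    fix S T assume S: "?op S" and T: "?op T"
    then show "S \<inter> T \<subseteq> (\<Union>\<sigma>\<in>K. closed_simplex \<sigma>)" by blast
    have "S \<inter> T \<inter> closed_simplex \<sigma> = (S \<inter> closed_simplex \<sigma>) \<inter> (T \<inter> closed_simplex \<sigma>)" for \<sigma>
      by blast
    with S T show "\<forall>\<sigma>\<in>K. openin (subtopology (powertop_real UNIV) (closed_simplex \<sigma>))
        (S \<inter> T \<inter> closed_simplex \<sigma>)"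
      by (metis (no_types, lifting) openin_Int)
  next
    fix \<K> assume \<K>: "\<forall>S\<in>\<K>. ?op S"
    then show "\<Union>\<K> \<subseteq> (\<Union>\<sigma>\<in>K. closed_simplex \<sigma>)" by blast
    have "\<Union>\<K> \<inter> closed_simplex \<sigma> = (\<Union>S\<in>\<K>. S \<inter> closed_simplex \<sigma>)" for \<sigma>
      by blast
    with \<K> show "\<forall>\<sigma>\<in>K. openin (subtopology (powertop_real UNIV) (closed_simplex \<sigma>))
        (\<Union>\<K> \<inter> closed_simplex \<sigma>)"
      by (metis (no_types, lifting) openin_Union imageE)
  qed
  then show ?thesis
    by (simp add: geometric_realization_def)
qed

lemma topspace_geometric_realization:
  "topspace (geometric_realization K) = (\<Union>\<sigma>\<in>K. closed_simplex \<sigma>)"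
proof
  show "topspace (geometric_realization K) \<subseteq> (\<Union>\<sigma>\<in>K. closed_simplex \<sigma>)"
    using openin_geometric_realization openin_topspace by metis
  have "(\<Union>\<tau>\<in>K. closed_simplex \<tau>) \<inter> closed_simplex \<sigma> = closed_simplex \<sigma>" if "\<sigma> \<in> K" for \<sigma>
    using that by blast
  moreover have "openin (subtopology (powertop_real UNIV) S) S" for S :: "('a \<Rightarrow> real) set"
    using openin_topspace[of "subtopology (powertop_real UNIV) S"] by simp
  ultimately have "openin (geometric_realization K) (\<Union>\<sigma>\<in>K. closed_simplex \<sigma>)"
    by (simp add: openin_geometric_realization)
  then show "(\<Union>\<sigma>\<in>K. closed_simplex \<sigma>) \<subseteq> topspace (geometric_realization K)"
    by (rule openin_subset)
qed

text \<open>The vertices of a triangulation correspond to distinct points of \<open>X\<close>, so it is no restriction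
  to draw them from the type of points of \<open>X\<close>.\<close>

definition triangulates :: "'a set set \<Rightarrow> 'a topology \<Rightarrow> bool" where
  "triangulates K X \<longleftrightarrow>
     abstract_simplicial_complex K \<and> geometric_realization K homeomorphic_space X"

definition triangulable :: "'a topology \<Rightarrow> bool" where
  "triangulable X \<longleftrightarrow> (\<exists>K. triangulates K X)"

text \<open>Meaningful for compact triangulable \<open>X\<close>, where every triangulation is finite.\<close>

definition min_vertices :: "'a topology \<Rightarrow> nat" where
  "min_vertices X = (LEAST n. \<exists>K. triangulates K X \<and> finite (\<Union>K) \<and> card (\<Union>K) = n)"

section \<open>Singular cohomology and the cup product\<close>

text \<open>A cochain with coefficients in \<open>'r\<close> is given by its values on singular simplices;
  it is normalized to be zero on everything else.\<close>

type_synonym ('a, 'r) cochain = "((nat \<Rightarrow> real) \<Rightarrow> 'a) \<Rightarrow> 'r"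

definition cochains :: "nat \<Rightarrow> 'a topology \<Rightarrow> ('a, 'r::comm_ring_1) cochain set" where
  "cochains q X = {c. \<forall>\<sigma>. \<not> singular_simplex q X \<sigma> \<longrightarrow> c \<sigma> = 0}"

definition coboundary ::
    "nat \<Rightarrow> 'a topology \<Rightarrow> ('a, 'r::comm_ring_1) cochain \<Rightarrow> ('a, 'r) cochain" where
  "coboundary q X c = (\<lambda>\<sigma>. if singular_simplex (Suc q) X \<sigma>
     then \<Sum>k\<le>Suc q. (-1) ^ k * c (singular_face (Suc q) k \<sigma>) else 0)"

definition cocycles :: "nat \<Rightarrow> 'a topology \<Rightarrow> ('a, 'r::comm_ring_1) cochain set" where
  "cocycles q X = {c \<in> cochains q X. coboundary q X c = (\<lambda>\<sigma>. 0)}"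

fun coboundaries :: "nat \<Rightarrow> 'a topology \<Rightarrow> ('a, 'r::comm_ring_1) cochain set" where
  "coboundaries 0 X = {\<lambda>\<sigma>. 0}"
| "coboundaries (Suc q) X = coboundary q X ` cochains q X"

definition cocycle_group :: "nat \<Rightarrow> 'a topology \<Rightarrow> ('a, 'r::comm_ring_1) cochain monoid" where
  "cocycle_group q X =
     \<lparr>carrier = cocycles q X, monoid.mult = (\<lambda>a b \<sigma>. a \<sigma> + b \<sigma>), one = (\<lambda>\<sigma>. 0)\<rparr>"

definition cohomology_group ::
    "nat \<Rightarrow> 'a topology \<Rightarrow> ('a, 'r::comm_ring_1) cochain set monoid" where
  "cohomology_group q X = cocycle_group q X Mod coboundaries q X"

definition cohomology_class ::
    "nat \<Rightarrow> 'a topology \<Rightarrow> ('a, 'r::comm_ring_1) cochain \<Rightarrow> ('a, 'r) cochain set" where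
  "cohomology_class q X z = coboundaries q X #>\<^bsub>cocycle_group q X\<^esub> z"

text \<open>Homomorphisms and products of classes are defined through all representatives at once:
  the members of the unions below all coincide.\<close>

definition cochain_restrict ::
    "nat \<Rightarrow> 'a topology \<Rightarrow> 'a set \<Rightarrow> ('a, 'r::comm_ring_1) cochain \<Rightarrow> ('a, 'r) cochain" where
  "cochain_restrict q X A c = (\<lambda>\<sigma>. if singular_simplex q (subtopology X A) \<sigma> then c \<sigma> else 0)"

definition class_restrict ::
    "nat \<Rightarrow> 'a topology \<Rightarrow> 'a set \<Rightarrow> ('a, 'r::comm_ring_1) cochain set \<Rightarrow> ('a, 'r) cochain set" where
  "class_restrict q X A u =
     (\<Union>z\<in>u. cohomology_class q (subtopology X A) (cochain_restrict q X A z))"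

text \<open>The faces spanned by the first \<open>p + 1\<close> and by the last \<open>q + 1\<close> vertices of a
  \<open>(p + q)\<close>-simplex.\<close>

definition front_face :: "nat \<Rightarrow> ((nat \<Rightarrow> real) \<Rightarrow> 'a) \<Rightarrow> (nat \<Rightarrow> real) \<Rightarrow> 'a" where
  "front_face p \<sigma> = restrict \<sigma> (standard_simplex p)"

definition back_face :: "nat \<Rightarrow> nat \<Rightarrow> ((nat \<Rightarrow> real) \<Rightarrow> 'a) \<Rightarrow> (nat \<Rightarrow> real) \<Rightarrow> 'a" where
  "back_face p q \<sigma> =
     restrict (\<lambda>x. \<sigma> (\<lambda>i. if i < p then 0 else x (i - p))) (standard_simplex q)"

definition cochain_cup :: "nat \<Rightarrow> nat \<Rightarrow> 'a topology \<Rightarrow>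
    ('a, 'r::comm_ring_1) cochain \<Rightarrow> ('a, 'r) cochain \<Rightarrow> ('a, 'r) cochain" where
  "cochain_cup p q X a b = (\<lambda>\<sigma>. if singular_simplex (p + q) X \<sigma>
     then a (front_face p \<sigma>) * b (back_face p q \<sigma>) else 0)"

definition class_cup :: "nat \<Rightarrow> nat \<Rightarrow> 'a topology \<Rightarrow>
    ('a, 'r::comm_ring_1) cochain set \<Rightarrow> ('a, 'r) cochain set \<Rightarrow> ('a, 'r) cochain set" where
  "class_cup p q X u v = (\<Union>a\<in>u. \<Union>b\<in>v. cohomology_class (p + q) X (cochain_cup p q X a b))"

definition unit_class :: "'a topology \<Rightarrow> ('a, 'r::comm_ring_1) cochain set" where
  "unit_class X = cohomology_class 0 X (\<lambda>\<sigma>. if singular_simplex 0 X \<sigma> then 1 else 0)"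

text \<open>Homogeneous elements carry their degree as first component. The groups are written
  multiplicatively, so the zero class is the neutral element \<open>\<one>\<close>.\<close>

type_synonym ('a, 'r) homogeneous = "nat \<times> ('a, 'r) cochain set"

definition is_zero :: "'a topology \<Rightarrow> ('a, 'r::comm_ring_1) homogeneous \<Rightarrow> bool" where
  "is_zero X = (\<lambda>(q, u). u = \<one>\<^bsub>cohomology_group q X\<^esub>)"

definition hrestrict ::
    "'a topology \<Rightarrow> 'a set \<Rightarrow> ('a, 'r::comm_ring_1) homogeneous \<Rightarrow> ('a, 'r) homogeneous" where
  "hrestrict X A = (\<lambda>(q, u). (q, class_restrict q X A u))"

text \<open>Reduced cohomology is the kernel of the restriction to a base point, an ideal of the
  cohomology ring. For path-connected \<open>X\<close> its elements are those of positive degree, together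
  with the zero class in degree 0.\<close>

definition reduced_homogeneous ::
    "'a topology \<Rightarrow> 'a \<Rightarrow> ('a, 'r::comm_ring_1) homogeneous set" where
  "reduced_homogeneous X x0 =
     {(q, u). u \<in> carrier (cohomology_group q X) \<and> is_zero (subtopology X {x0}) (hrestrict X {x0} (q, u))}"

fun seq_product :: "'a topology \<Rightarrow> ('a, 'r::comm_ring_1) homogeneous list \<Rightarrow> ('a, 'r) homogeneous" where
  "seq_product X [] = (0, unit_class X)"
| "seq_product X ((p, u) # s) =
     (p + fst (seq_product X s), class_cup p (fst (seq_product X s)) X u (snd (seq_product X s)))"

section \<open>Category and category weight\<close>

definition categorical_in :: "'a topology \<Rightarrow> 'a set \<Rightarrow> bool" where
  "categorical_in X A \<longleftrightarrow> A \<subseteq> topspace X \<and>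
     (\<exists>c\<in>topspace X. homotopic_with (\<lambda>_. True) (subtopology X A) X id (\<lambda>_. c))"

text \<open>Not normalized: a nonempty contractible space has category 1. The value is \<open>\<infinity>\<close> if there
  is no finite cover of the required kind.\<close>

definition ls_cat :: "'a topology \<Rightarrow> 'a set \<Rightarrow> enat" where
  "ls_cat X A = Inf {enat k | k. \<exists>U :: nat \<Rightarrow> 'a set. A = (\<Union>i<k. U i) \<and>
     (\<forall>i<k. openin (subtopology X A) (U i) \<and> categorical_in X (U i))}"

text \<open>The set of admissible \<open>k\<close> is downward closed, so the supremum is the maximum
  whenever a maximum exists, and \<open>\<infinity>\<close> otherwise.\<close>

definition cwgt :: "'a topology \<Rightarrow> ('a, 'r::comm_ring_1) homogeneous \<Rightarrow> enat" where
  "cwgt X u = Sup {enat k | k. \<forall>A. closedin X A \<and> ls_cat X A \<le> enat k \<longrightarrow>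
     is_zero (subtopology X A) (hrestrict X A u)}"

text \<open>The values of \<open>w\<close> outside the nonzero reduced classes are irrelevant.\<close>

definition weight_estimator ::
    "'a topology \<Rightarrow> 'a \<Rightarrow> (('a, 'r::comm_ring_1) homogeneous \<Rightarrow> nat) \<Rightarrow> bool" where
  "weight_estimator X x0 w \<longleftrightarrow>
     (\<forall>u \<in> reduced_homogeneous X x0. \<not> is_zero X u \<longrightarrow> 0 < w u \<and> enat (w u) \<le> cwgt X u)"

definition seq_weight :: "(('a, 'r) homogeneous \<Rightarrow> nat) \<Rightarrow> ('a, 'r) homogeneous list \<Rightarrow> nat" where
  "seq_weight w s = sum_list (map w s)"

definition seq_degree :: "'a topology \<Rightarrow> ('a, 'r::comm_ring_1) homogeneous list \<Rightarrow> int" where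
  "seq_degree X s = (if s = [] then -1 else int (fst (seq_product X s)))"

text \<open>Subsequences up to permutation are submultisets.\<close>

definition wct :: "'a topology \<Rightarrow> (('a, 'r::comm_ring_1) homogeneous \<Rightarrow> nat) \<Rightarrow>
    ('a, 'r) homogeneous list \<Rightarrow> int" where
  "wct X w s = 1 + int (seq_weight w s) +
     (\<Sum>k = 1..seq_weight w s.
        Max {seq_degree X s' | s'. mset s' \<subseteq># mset s \<and> seq_weight w s' \<le> k})"

end

theory Submission
  imports Defs
begin

text \<open>Let \<open>W\<close> be the total weight and let \<open>K\<close> triangulate \<open>X\<close> with the least number of vertices.
  Remove \<open>W\<close> times the vertices of a largest simplex spanned by the vertices still present. Suppose
  that after \<open>j\<close> removals all simplices on the remaining vertex set \<open>A\<close> have at most \<open>d\<close> vertices.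
  Then \<open>X\<close> is covered by the open stars of the \<open>j\<close> removed simplices, which are categorical, and by
  the open star of \<open>A\<close>, which is a union of \<open>d\<close> open sets all of whose intersections are disjoint
  unions of star-shaped sets. A class of weight \<open>k\<close> vanishes on a union of \<open>k\<close> (slightly shrunk) sets
  of the first kind, and by Mayer-Vietoris a class of degree \<open>q\<close> vanishes on a union of \<open>q\<close> sets of
  the second kind. If some of the factors have total degree at least \<open>d\<close> and the others have total
  weight at least \<open>j\<close>, then each factor vanishes on one member of an open cover of \<open>X\<close>, and the
  product is zero. Since every factor is dealt with separately, no commutativity of the cup product
  is needed. Hence for a nonzero product the simplex removed from \<open>A\<close> has more vertices than the
  degree of any subsequence of weight at most \<open>W - j\<close>, and after \<open>W\<close> removals a vertex is left.\<close>

section \<open>Cochains, classes and the Leibniz rule\<close>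

text \<open>Category weight is tested on closed sets, while cochain products are compared on open
  covers. So each star is used at two thresholds: mass greater than \<open>\<epsilon>\<close> for
  the cover, mass at least \<open>\<epsilon>\<close> for the closed set; with
  \<open>\<epsilon>\<close> = 1/(j+1), a point without mass in A exceeds the threshold for some
  removed simplex. The d open sets come from the barycentric subdivision: its vertices are coloured
  by the cardinality of the simplices they stand for, and stars of equal colour are disjoint.
  Simplices with at most d vertices need d colours, one more than their dimension, so classes die
  from degree d on, and a nonzero product forces the next removed simplex to have at least degree
  plus one vertices. These W extra vertices and the one left at the end produce the summand 1 + W.
  Working with cochains instead of relative groups gives each factor its own set: a representative
  that is zero on the simplices of that set is enough, since a cocycle that is zero on all small
  simplices is a coboundary.\<close>

definition cochain_eval :: "('a, 'r::comm_ring_1) cochain \<Rightarrow> 'a chain \<Rightarrow> 'r" where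
  "cochain_eval c x = (\<Sum>\<sigma>\<in>Poly_Mapping.keys x. of_int (Poly_Mapping.lookup x \<sigma>) * c \<sigma>)"

lemma cochain_eval_superset:
  assumes "finite A" "Poly_Mapping.keys x \<subseteq> A"
  shows "cochain_eval c x = (\<Sum>\<sigma>\<in>A. of_int (Poly_Mapping.lookup x \<sigma>) * c \<sigma>)"
  unfolding cochain_eval_def
  using assms by (intro sum.mono_neutral_left) (auto simp: in_keys_iff)

lemma cochain_eval_0 [simp]: "cochain_eval c 0 = 0"
  by (simp add: cochain_eval_def)

lemma cochain_eval_of [simp]: "cochain_eval c (frag_of \<sigma>) = c \<sigma>"
  by (simp add: cochain_eval_def)

lemma cochain_eval_add: "cochain_eval c (x + y) = cochain_eval c x + cochain_eval c y"
proof -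
  let ?A = "Poly_Mapping.keys x \<union> Poly_Mapping.keys y"
  have "cochain_eval c z = (\<Sum>\<sigma>\<in>?A. of_int (Poly_Mapping.lookup z \<sigma>) * c \<sigma>)" if "z \<in> {x, y, x + y}" for z
    using that keys_add[of x y] by (intro cochain_eval_superset) auto
  then show ?thesis
    by (simp add: lookup_add sum.distrib algebra_simps)
qed

lemma cochain_eval_minus: "cochain_eval c (- x) = - cochain_eval c x"
  using cochain_eval_add[of c x "- x"] by (simp add: eq_neg_iff_add_eq_0 add.commute)

lemma cochain_eval_diff: "cochain_eval c (x - y) = cochain_eval c x - cochain_eval c y"
  using cochain_eval_add[of c x "- y"] by (simp add: cochain_eval_minus)

lemma cochain_eval_sum: "cochain_eval c (sum f A) = (\<Sum>i\<in>A. cochain_eval c (f i))"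
  by (induction A rule: infinite_finite_induct) (simp_all add: cochain_eval_add)

lemma cochain_eval_sign: "cochain_eval c (frag_cmul ((-1) ^ k) x) = (-1) ^ k * cochain_eval c x"
  by (cases "even k") (simp_all add: cochain_eval_minus)

lemma coboundary_eq_eval:
  assumes "singular_simplex (Suc q) X \<sigma>"
  shows "coboundary q X c \<sigma> = cochain_eval c (chain_boundary (Suc q) (frag_of \<sigma>))"
  using assms by (simp add: coboundary_def chain_boundary_of cochain_eval_sum cochain_eval_sign
      del: sum.atMost_Suc)

text \<open>The coboundary is the transpose of \<open>chain_boundary\<close>; through this pairing,
  subdivision and chain homotopies act on cochains.\<close>

lemma cochain_eval_coboundary:
  assumes "singular_chain (Suc q) X x"
  shows "cochain_eval (coboundary q X c) x = cochain_eval c (chain_boundary (Suc q) x)"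
  using assms unfolding singular_chain_def
  by (induction x rule: frag_induction)
     (auto simp: coboundary_eq_eval cochain_eval_diff chain_boundary_diff)

lemma cocycle_eval_boundary:
  assumes "c \<in> cocycles q X" "singular_chain (Suc q) X x"
  shows "cochain_eval c (chain_boundary (Suc q) x) = 0"
  using assms cochain_eval_coboundary[OF assms(2), of c]
  by (auto simp: cocycles_def cochain_eval_def)

lemma coboundary_in_cochains: "coboundary q X c \<in> cochains (Suc q) X"
  by (simp add: cochains_def coboundary_def)

lemma coboundary_coboundary [simp]: "coboundary (Suc q) X (coboundary q X c) = (\<lambda>\<sigma>. 0)"
proof
  fix \<sigma>
  show "coboundary (Suc q) X (coboundary q X c) \<sigma> = 0"
  proof (cases "singular_simplex (Suc (Suc q)) X \<sigma>")
    case True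
    then have ch: "singular_chain (Suc (Suc q)) X (frag_of \<sigma>)"
      by (simp add: singular_chain_of)
    have "singular_chain (Suc q) X (chain_boundary (Suc (Suc q)) (frag_of \<sigma>))"
      using singular_chain_boundary_alt[OF ch] .
    then show ?thesis
      using True ch
      by (simp add: coboundary_eq_eval cochain_eval_coboundary chain_boundary_boundary_alt)
  qed (simp add: coboundary_def)
qed

lemma cochains_zero: "(\<lambda>\<sigma>. 0) \<in> cochains q X"
  and cochains_add: "a \<in> cochains q X \<Longrightarrow> b \<in> cochains q X \<Longrightarrow> (\<lambda>\<sigma>. a \<sigma> + b \<sigma>) \<in> cochains q X"
  and cochains_diff: "a \<in> cochains q X \<Longrightarrow> b \<in> cochains q X \<Longrightarrow> (\<lambda>\<sigma>. a \<sigma> - b \<sigma>) \<in> cochains q X"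
  by (simp_all add: cochains_def)

lemma coboundary_zero [simp]: "coboundary q X (\<lambda>\<sigma>. 0) = (\<lambda>\<sigma>. 0)"
  by (simp add: coboundary_def fun_eq_iff)

lemma coboundary_add:
  "coboundary q X (\<lambda>\<sigma>. a \<sigma> + b \<sigma>) = (\<lambda>\<sigma>. coboundary q X a \<sigma> + coboundary q X b \<sigma>)"
  by (simp add: coboundary_def fun_eq_iff sum.distrib distrib_left del: sum.atMost_Suc)

lemma coboundary_diff:
  "coboundary q X (\<lambda>\<sigma>. a \<sigma> - b \<sigma>) = (\<lambda>\<sigma>. coboundary q X a \<sigma> - coboundary q X b \<sigma>)"
  by (simp add: coboundary_def fun_eq_iff sum_subtractf right_diff_distrib del: sum.atMost_Suc)

lemma coboundary_cmul:
  "coboundary q X (\<lambda>\<sigma>. r * a \<sigma>) = (\<lambda>\<sigma>. r * coboundary q X a \<sigma>)"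
  by (simp add: coboundary_def fun_eq_iff sum_distrib_left mult.left_commute del: sum.atMost_Suc)

lemma cocycles_add: "a \<in> cocycles q X \<Longrightarrow> b \<in> cocycles q X \<Longrightarrow> (\<lambda>\<sigma>. a \<sigma> + b \<sigma>) \<in> cocycles q X"
  and cocycles_diff: "a \<in> cocycles q X \<Longrightarrow> b \<in> cocycles q X \<Longrightarrow> (\<lambda>\<sigma>. a \<sigma> - b \<sigma>) \<in> cocycles q X"
  by (simp_all add: cocycles_def cochains_add cochains_diff coboundary_add coboundary_diff)

lemma coboundaries_zero: "(\<lambda>\<sigma>. 0) \<in> coboundaries q X"
  by (cases q) (auto intro!: image_eqI[OF _ cochains_zero])

lemma coboundaries_add:
  "a \<in> coboundaries q X \<Longrightarrow> b \<in> coboundaries q X \<Longrightarrow> (\<lambda>\<sigma>. a \<sigma> + b \<sigma>) \<in> coboundaries q X"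
  by (cases q) (auto simp flip: coboundary_add intro!: imageI cochains_add)

lemma coboundaries_diff:
  "a \<in> coboundaries q X \<Longrightarrow> b \<in> coboundaries q X \<Longrightarrow> (\<lambda>\<sigma>. a \<sigma> - b \<sigma>) \<in> coboundaries q X"
  by (cases q) (auto simp flip: coboundary_diff intro!: imageI cochains_diff)

lemma coboundaries_subset_cocycles: "coboundaries q X \<subseteq> cocycles q X"
  by (cases q) (auto simp: cocycles_def coboundary_in_cochains cochains_zero)

lemma cohomology_class_eq:
  "cohomology_class q X z = {\<lambda>\<sigma>. b \<sigma> + z \<sigma> | b. b \<in> coboundaries q X}"
  by (auto simp: cohomology_class_def r_coset_def cocycle_group_def)

lemma in_cohomology_class_iff:
  "y \<in> cohomology_class q X z \<longleftrightarrow> (\<lambda>\<sigma>. y \<sigma> - z \<sigma>) \<in> coboundaries q X"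
proof
  assume "(\<lambda>\<sigma>. y \<sigma> - z \<sigma>) \<in> coboundaries q X"
  then show "y \<in> cohomology_class q X z"
    unfolding cohomology_class_eq by (intro CollectI exI[of _ "\<lambda>\<sigma>. y \<sigma> - z \<sigma>"]) auto
qed (auto simp: cohomology_class_eq)

lemma cohomology_class_cong:
  assumes "(\<lambda>\<sigma>. y \<sigma> - z \<sigma>) \<in> coboundaries q X"
  shows "cohomology_class q X y = cohomology_class q X z"
proof -
  have "(\<lambda>\<sigma>. x \<sigma> - y \<sigma>) \<in> coboundaries q X \<longleftrightarrow> (\<lambda>\<sigma>. x \<sigma> - z \<sigma>) \<in> coboundaries q X" for x
    using coboundaries_add[OF _ assms, of "\<lambda>\<sigma>. x \<sigma> - y \<sigma>"] coboundaries_diff[OF _ assms, of "\<lambda>\<sigma>. x \<sigma> - z \<sigma>"]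
    by auto
  then show ?thesis
    by (simp add: set_eq_iff in_cohomology_class_iff)
qed

lemma carrier_cohomology_group:
  "carrier (cohomology_group q X) = cohomology_class q X ` cocycles q X"
  by (auto simp: cohomology_group_def FactGroup_def RCOSETS_def cohomology_class_def cocycle_group_def)

lemma is_zero_iff: "is_zero X (q, u) \<longleftrightarrow> u = coboundaries q X"
  by (simp add: is_zero_def cohomology_group_def)

lemma is_zero_class_iff: "is_zero X (q, cohomology_class q X z) \<longleftrightarrow> z \<in> coboundaries q X"
proof
  assume "is_zero X (q, cohomology_class q X z)"
  then show "z \<in> coboundaries q X"
    using in_cohomology_class_iff[of z q X z] by (auto simp: is_zero_iff coboundaries_zero)
next
  assume z: "z \<in> coboundaries q X"
  have "y \<in> cohomology_class q X z \<longleftrightarrow> y \<in> coboundaries q X" for y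
    using coboundaries_add[OF _ z, of "\<lambda>\<sigma>. y \<sigma> - z \<sigma>"] coboundaries_diff[OF _ z, of y]
    by (auto simp: in_cohomology_class_iff)
  then show "is_zero X (q, cohomology_class q X z)"
    by (auto simp: is_zero_iff)
qed

section \<open>Front and back faces, and their behaviour under face maps\<close>

lemma simplical_face_drop:
  fixes x :: "nat \<Rightarrow> 'b::comm_monoid_add"
  assumes "k \<le> p"
  shows "simplical_face k (\<lambda>i. if i < p then 0 else x (i - p)) = (\<lambda>i. if i < Suc p then 0 else x (i - Suc p))"
  using assms by (auto simp: simplical_face_def fun_eq_iff)

lemma simplical_face_shift:
  fixes x :: "nat \<Rightarrow> 'b::comm_monoid_add"
  shows "simplical_face (p + j) (\<lambda>i. if i < p then 0 else x (i - p)) = (\<lambda>i. if i < p then 0 else simplical_face j x (i - p))"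
  by (auto simp: simplical_face_def fun_eq_iff)

lemma shift_in_standard_simplex:
  assumes "x \<in> standard_simplex q"
  shows "(\<lambda>i. if i < p then 0 else x (i - p)) \<in> standard_simplex (p + q)"
proof -
  have "(\<Sum>i\<le>p + q. if i < p then 0 else x (i - p)) = (\<Sum>i\<in>{p..p + q}. x (i - p))"
    by (rule sum.mono_neutral_cong_right) auto
  also have "\<dots> = (\<Sum>i\<le>q. x i)"
    using sum.atLeastAtMost_shift_bounds[of "\<lambda>i. x (i - p)" 0 p q]
    by (simp add: atLeast0AtMost add.commute)
  finally show ?thesis
    using assms by (auto simp: standard_simplex_def)
qed

lemma continuous_shift_standard_simplex:
  "continuous_map (subtopology (powertop_real UNIV) (standard_simplex q))
     (subtopology (powertop_real UNIV) (standard_simplex (p + q))) (\<lambda>x i. if i < p then 0 else x (i - p))"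
proof -
  have "continuous_map (subtopology (powertop_real UNIV) (standard_simplex q)) euclideanreal
      (\<lambda>x. if i < p then 0 else x (i - p))" for i :: nat
    by (cases "i < p") (auto intro: continuous_map_from_subtopology continuous_map_product_projection)
  then show ?thesis
    by (auto simp: continuous_map_in_subtopology continuous_map_componentwise shift_in_standard_simplex
        simp del: if_split)
qed

lemma singular_simplex_front_face:
  assumes "singular_simplex (p + q) X \<sigma>"
  shows "singular_simplex p X (front_face p \<sigma>)"
proof -
  have "continuous_map (subtopology (powertop_real UNIV) (standard_simplex p)) X \<sigma>"
    using assms standard_simplex_mono[of p "p + q"]
    by (auto simp: singular_simplex_def intro: continuous_map_from_subtopology_mono)
  then show ?thesis
    by (simp add: singular_simplex_def front_face_def)
qed

lemma singular_simplex_back_face: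
  assumes "singular_simplex (p + q) X \<sigma>"
  shows "singular_simplex q X (back_face p q \<sigma>)"
  using assms continuous_map_compose[OF continuous_shift_standard_simplex, of p q X \<sigma>]
  by (simp add: singular_simplex_def back_face_def o_def)

lemma simplical_face_Suc_in_standard_simplex:
  "k \<le> Suc p \<Longrightarrow> x \<in> standard_simplex p \<Longrightarrow> simplical_face k x \<in> standard_simplex (Suc p)"
  using simplical_face_in_standard_simplex[of "Suc p" k x] by simp

lemma simplical_face_beyond:
  fixes x :: "nat \<Rightarrow> real"
  assumes "x \<in> standard_simplex p" "p < k"
  shows "simplical_face k x = x"
  using assms by (auto simp: simplical_face_def fun_eq_iff standard_simplex_def)

text \<open>The ranges of k here and in the next lemma overlap at p + 1, and those of the two back
  face lemmas overlap at p. The overlaps identify the two terms that cancel in the Leibniz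
  rule.\<close>

lemma front_face_singular_face_low:
  assumes "k \<le> Suc p"
  shows "front_face p (singular_face (Suc (p + q)) k \<sigma>) = singular_face (Suc p) k (front_face (Suc p) \<sigma>)"
proof
  fix x
  show "front_face p (singular_face (Suc (p + q)) k \<sigma>) x = singular_face (Suc p) k (front_face (Suc p) \<sigma>) x"
    using assms standard_simplex_mono[of p "p + q"]
    by (auto simp: front_face_def singular_face_def simplical_face_Suc_in_standard_simplex)
qed

lemma front_face_singular_face_high:
  assumes "p < k"
  shows "front_face p (singular_face (Suc (p + q)) k \<sigma>) = front_face p \<sigma>"
proof
  fix x
  show "front_face p (singular_face (Suc (p + q)) k \<sigma>) x = front_face p \<sigma> x"
    using assms standard_simplex_mono[of p "p + q"]
    by (auto simp: front_face_def singular_face_def simplical_face_beyond)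
qed

lemma back_face_singular_face_low:
  assumes "k \<le> p"
  shows "back_face p q (singular_face (Suc (p + q)) k \<sigma>) = back_face (Suc p) q \<sigma>"
proof
  fix x
  show "back_face p q (singular_face (Suc (p + q)) k \<sigma>) x = back_face (Suc p) q \<sigma> x"
    using assms
    by (auto simp: back_face_def singular_face_def shift_in_standard_simplex simplical_face_drop)
qed

lemma back_face_singular_face_high:
  assumes "j \<le> Suc q"
  shows "back_face p q (singular_face (Suc (p + q)) (p + j) \<sigma>) = singular_face (Suc q) j (back_face p (Suc q) \<sigma>)"
proof
  fix x
  show "back_face p q (singular_face (Suc (p + q)) (p + j) \<sigma>) x = singular_face (Suc q) j (back_face p (Suc q) \<sigma>) x"
    using assms
    by (auto simp: back_face_def singular_face_def shift_in_standard_simplex simplical_face_shift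
        simplical_face_Suc_in_standard_simplex)
qed

lemma cochain_cup_in_cochains: "cochain_cup p q X a b \<in> cochains (p + q) X"
  by (simp add: cochains_def cochain_cup_def)

text \<open>In the Leibniz rule the last face of the front part and the zeroth face of the back part
  give the same product with opposite signs.\<close>

lemma coboundary_cochain_cup:
  "coboundary (p + q) X (cochain_cup p q X a b) =
     (\<lambda>\<sigma>. cochain_cup (Suc p) q X (coboundary p X a) b \<sigma>
        + (-1) ^ p * cochain_cup p (Suc q) X a (coboundary q X b) \<sigma>)"
proof
  fix \<sigma>
  show "coboundary (p + q) X (cochain_cup p q X a b) \<sigma> =
     cochain_cup (Suc p) q X (coboundary p X a) b \<sigma>
        + (-1) ^ p * cochain_cup p (Suc q) X a (coboundary q X b) \<sigma>"
  proof (cases "singular_simplex (Suc (p + q)) X \<sigma>")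
    case True
    define A where "A = (\<lambda>k. a (singular_face (Suc p) k (front_face (Suc p) \<sigma>)))"
    define B where "B = (\<lambda>k. b (singular_face (Suc q) k (back_face p (Suc q) \<sigma>)))"
    define f where "f = (\<lambda>k. (-1) ^ k * (a (front_face p (singular_face (Suc (p + q)) k \<sigma>))
                           * b (back_face p q (singular_face (Suc (p + q)) k \<sigma>))))"
    have sing: "singular_simplex (p + q) X (singular_face (Suc (p + q)) k \<sigma>)" if "k \<le> Suc (p + q)" for k
      using singular_simplex_singular_face[OF True, of k] that by simp
    have "singular_simplex (Suc p) X (front_face (Suc p) \<sigma>)" "singular_simplex (Suc q) X (back_face p (Suc q) \<sigma>)"
      using True singular_simplex_front_face[of "Suc p" q X \<sigma>] singular_simplex_back_face[of p "Suc q" X \<sigma>] by simp_all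
    then have cup1: "cochain_cup (Suc p) q X (coboundary p X a) b \<sigma> = (\<Sum>k\<le>Suc p. (-1) ^ k * A k) * b (back_face (Suc p) q \<sigma>)"
      and cup2: "cochain_cup p (Suc q) X a (coboundary q X b) \<sigma> = a (front_face p \<sigma>) * (\<Sum>j\<le>Suc q. (-1) ^ j * B j)"
      using True by (simp_all add: cochain_cup_def coboundary_def A_def B_def)
    have low: "f k = (-1) ^ k * A k * b (back_face (Suc p) q \<sigma>)" if "k \<le> p" for k
      using that by (simp add: f_def A_def front_face_singular_face_low back_face_singular_face_low)
    have high: "f (Suc (p + j)) = (-1) ^ p * (a (front_face p \<sigma>) * ((-1) ^ Suc j * B (Suc j)))" if "j \<le> q" for j
      using that back_face_singular_face_high[of "Suc j" q p \<sigma>]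
      by (simp add: f_def B_def front_face_singular_face_high power_add)
    have split: "(\<Sum>k<m + n. f k) = (\<Sum>k<m. f k) + (\<Sum>j<n. f (m + j))" for m n
      by (induction n) (simp_all add: add.assoc)
    have Alast: "A (Suc p) = a (front_face p \<sigma>)"
      using front_face_singular_face_low[of "Suc p" p q \<sigma>] front_face_singular_face_high[of p "Suc p" q \<sigma>]
      by (simp add: A_def)
    have Bfirst: "B 0 = b (back_face (Suc p) q \<sigma>)"
      using back_face_singular_face_low[of p p q \<sigma>] back_face_singular_face_high[of 0 q p \<sigma>]
      by (simp add: B_def)
    have "coboundary (p + q) X (cochain_cup p q X a b) \<sigma> = (\<Sum>k\<le>Suc (p + q). f k)"
      using True sing by (simp add: coboundary_def cochain_cup_def f_def del: sum.atMost_Suc)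
    \<comment> \<open>The p + q + 2 faces are cut after index p: up to there only the front factor
      varies, beyond it only the back factor.\<close>
    also have "\<dots> = (\<Sum>k<Suc p + Suc q. f k)"
      by (simp add: lessThan_Suc_atMost[symmetric] del: sum.atMost_Suc sum.lessThan_Suc)
    also have "\<dots> = (\<Sum>k<Suc p. f k) + (\<Sum>j<Suc q. f (Suc p + j))"
      by (rule split)
    also have "(\<Sum>k<Suc p. f k) = (\<Sum>k\<le>p. (-1) ^ k * A k) * b (back_face (Suc p) q \<sigma>)"
      by (simp add: low lessThan_Suc_atMost sum_distrib_right)
    also have "(\<Sum>j<Suc q. f (Suc p + j)) = (-1) ^ p * (a (front_face p \<sigma>) * (\<Sum>j\<le>q. (-1) ^ Suc j * B (Suc j)))"
      by (simp add: high lessThan_Suc_atMost sum_distrib_left del: power_Suc)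
    finally have lhs: "coboundary (p + q) X (cochain_cup p q X a b) \<sigma> =
        (\<Sum>k\<le>p. (-1) ^ k * A k) * b (back_face (Suc p) q \<sigma>)
        + (-1) ^ p * (a (front_face p \<sigma>) * (\<Sum>j\<le>q. (-1) ^ Suc j * B (Suc j)))" .
    have SA: "(\<Sum>k\<le>Suc p. (-1) ^ k * A k) = (\<Sum>k\<le>p. (-1) ^ k * A k) - (-1) ^ p * a (front_face p \<sigma>)"
      by (simp add: Alast)
    have SB: "(\<Sum>j\<le>Suc q. (-1) ^ j * B j) = b (back_face (Suc p) q \<sigma>) + (\<Sum>j\<le>q. (-1) ^ Suc j * B (Suc j))"
      by (subst sum.atMost_Suc_shift) (simp add: Bfirst)
    show ?thesis
      unfolding lhs cup1 cup2 SA SB by (simp add: algebra_simps del: sum.atMost_Suc power_Suc)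
  qed (simp add: coboundary_def cochain_cup_def)
qed

section \<open>Small chains\<close>

text \<open>The family is arbitrary: it will be an open cover, or \<open>{{b}}\<close>, where the
  small chains are the chains of a point.\<close>

definition small_chain :: "nat \<Rightarrow> 'a topology \<Rightarrow> 'a set set \<Rightarrow> 'a chain \<Rightarrow> bool" where
  "small_chain p X \<C> x \<longleftrightarrow>
     singular_chain p X x \<and> (\<forall>f\<in>Poly_Mapping.keys x. \<exists>V\<in>\<C>. f ` standard_simplex p \<subseteq> V)"

lemma small_chain_0 [simp]: "small_chain p X \<C> 0"
  by (simp add: small_chain_def)

lemma small_chain_add: "small_chain p X \<C> x \<Longrightarrow> small_chain p X \<C> y \<Longrightarrow> small_chain p X \<C> (x + y)"
  using keys_add[of x y] by (auto simp: small_chain_def singular_chain_add)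

lemma small_chain_minus: "small_chain p X \<C> (- x) \<longleftrightarrow> small_chain p X \<C> x"
  by (simp add: small_chain_def singular_chain_minus)

lemma small_chain_diff: "small_chain p X \<C> x \<Longrightarrow> small_chain p X \<C> y \<Longrightarrow> small_chain p X \<C> (x - y)"
  using small_chain_add[of p X \<C> x "- y"] by (simp add: small_chain_minus)

lemma small_chain_subtopology:
  assumes "V \<in> \<C>" "singular_chain p (subtopology X V) x"
  shows "small_chain p X \<C> x"
  using assms by (auto simp: small_chain_def singular_chain_subtopology)

lemma small_chain_induct [consumes 1, case_names zero one diff]:
  assumes "small_chain p X \<C> x" "P 0"
    and "\<And>f V. V \<in> \<C> \<Longrightarrow> singular_simplex p (subtopology X V) f \<Longrightarrow> P (frag_of f)"
    and "\<And>a b. P a \<Longrightarrow> P b \<Longrightarrow> P (a - b)"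
  shows "P x"
proof -
  have "Poly_Mapping.keys x \<subseteq> {f. \<exists>V\<in>\<C>. singular_simplex p (subtopology X V) f}"
    using assms(1) by (auto simp: small_chain_def singular_chain_def singular_simplex_subtopology)
  then show ?thesis
    by (induction x rule: frag_induction) (use assms in auto)
qed

text \<open>A chain homotopy from the identity into the small chains is built degree by degree; a cochain
  bounding a cocycle that vanishes on small simplices is that cocycle composed with it. The index is
  shifted: stage \<open>Suc p\<close> acts on chains of degree \<open>p\<close>, and stage 0 stands for degree -1.\<close>

primrec small_homotopy :: "'a topology \<Rightarrow> 'a set set \<Rightarrow> nat \<Rightarrow> 'a chain \<Rightarrow> 'a chain" where
  "small_homotopy X \<C> 0 = (\<lambda>x. 0)"
| "small_homotopy X \<C> (Suc p) = frag_extend (\<lambda>f. SOME y. singular_chain (Suc p) X y \<and>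
     small_chain p X \<C> (frag_of f - small_homotopy X \<C> p (chain_boundary p (frag_of f)) - chain_boundary (Suc p) y))"

lemma small_homotopy_diff: "small_homotopy X \<C> p (x - y) = small_homotopy X \<C> p x - small_homotopy X \<C> p y"
  by (cases p) (simp_all add: frag_extend_diff)

lemma small_homotopy_zero [simp]: "small_homotopy X \<C> p 0 = 0"
  by (cases p) simp_all

text \<open>For a simplex f, the boundary of f - D(boundary f) is what the previous stage leaves of
  the boundary of f, its inner term being zero because the boundary squares to zero. It is therefore
  small, and \<open>deform\<close> supplies the value that \<open>SOME\<close> picks. Linearity
  extends this to chains.\<close>

lemma small_homotopy:
  fixes X :: "'a topology"
  assumes deform: "\<And>p z. singular_chain p X z \<Longrightarrow> small_chain (p - Suc 0) X \<C> (chain_boundary p z)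
      \<Longrightarrow> \<exists>y. singular_chain (Suc p) X y \<and> small_chain p X \<C> (z - chain_boundary (Suc p) y)"
    and "singular_chain p X x"
  shows "singular_chain (Suc p) X (small_homotopy X \<C> (Suc p) x) \<and>
    small_chain p X \<C> (x - small_homotopy X \<C> p (chain_boundary p x)
      - chain_boundary (Suc p) (small_homotopy X \<C> (Suc p) x))"
proof -
  let ?D = "small_homotopy X \<C>"
  let ?P = "\<lambda>p x. singular_chain (Suc p) X (?D (Suc p) x) \<and>
    small_chain p X \<C> (x - ?D p (chain_boundary p x) - chain_boundary (Suc p) (?D (Suc p) x))"
  have extend: "?P p x"
    if x: "singular_chain p X x"
      and simplex: "\<And>f. singular_simplex p X f \<Longrightarrow> singular_chain p X (?D p (chain_boundary p (frag_of f))) \<and>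
        small_chain (p - Suc 0) X \<C> (chain_boundary p (frag_of f - ?D p (chain_boundary p (frag_of f))))"
    for p x
  proof -
    from x have "Poly_Mapping.keys x \<subseteq> {f. singular_simplex p X f}"
      by (simp add: singular_chain_def)
    then show ?thesis
    proof (induction x rule: frag_induction)
      case (one f)
      then have f: "singular_chain p X (frag_of f - ?D p (chain_boundary p (frag_of f)))"
        using simplex[of f] by (simp add: singular_chain_of singular_chain_diff)
      have "\<exists>y. singular_chain (Suc p) X y \<and>
         small_chain p X \<C> (frag_of f - ?D p (chain_boundary p (frag_of f)) - chain_boundary (Suc p) y)"
        using deform[OF f] simplex[of f] one by simp
      from someI_ex[OF this] show ?case
        by (simp only: small_homotopy.simps frag_extend_of)
    next
      case (diff a b)
      have "(a - b) - ?D p (chain_boundary p (a - b)) - chain_boundary (Suc p) (?D (Suc p) (a - b)) =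
          (a - ?D p (chain_boundary p a) - chain_boundary (Suc p) (?D (Suc p) a))
          - (b - ?D p (chain_boundary p b) - chain_boundary (Suc p) (?D (Suc p) b))"
        by (simp add: small_homotopy_diff chain_boundary_diff del: small_homotopy.simps)
      moreover have "?D (Suc p) (a - b) = ?D (Suc p) a - ?D (Suc p) b"
        by (rule small_homotopy_diff)
      ultimately show ?case
        using diff by (simp only: singular_chain_diff small_chain_diff)
    qed (simp del: small_homotopy.simps)
  qed
  show "?P p x"
    using assms(2)
  proof (induction p arbitrary: x)
    case 0
    show ?case
      by (rule extend[OF 0]) (simp add: chain_boundary_def)
  next
    case (Suc p)
    show ?case
    proof (rule extend[OF Suc.prems])
      fix f
      assume "singular_simplex (Suc p) X f"
      then have f: "singular_chain (Suc p) X (frag_of f)"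
        by (simp add: singular_chain_of)
      show "singular_chain (Suc p) X (?D (Suc p) (chain_boundary (Suc p) (frag_of f))) \<and>
          small_chain (Suc p - Suc 0) X \<C>
            (chain_boundary (Suc p) (frag_of f - ?D (Suc p) (chain_boundary (Suc p) (frag_of f))))"
        using Suc.IH[OF singular_chain_boundary_alt[OF f]] chain_boundary_boundary_alt[OF f]
        by (simp add: chain_boundary_diff del: small_homotopy.simps)
    qed
  qed
qed

text \<open>The cocycle c is zero on the small chain f - D(boundary f) - boundary(D f) and on its
  last term, so c f equals c(D(boundary f)), a cochain applied to the boundary of f.\<close>

lemma cocycle_vanishing_on_small:
  fixes X :: "'a topology" and c :: "('a, 'r::comm_ring_1) cochain"
  assumes deform: "\<And>p z. singular_chain p X z \<Longrightarrow> small_chain (p - Suc 0) X \<C> (chain_boundary p z)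
      \<Longrightarrow> \<exists>y. singular_chain (Suc p) X y \<and> small_chain p X \<C> (z - chain_boundary (Suc p) y)"
    and c: "c \<in> cocycles n X"
    and small: "\<And>V f. V \<in> \<C> \<Longrightarrow> singular_simplex n (subtopology X V) f \<Longrightarrow> c f = 0"
  shows "c \<in> coboundaries n X"
proof -
  let ?D = "small_homotopy X \<C>"
  have eval_small: "cochain_eval c x = 0" if "small_chain n X \<C> x" for x
    using that by (induction x rule: small_chain_induct) (auto simp: small cochain_eval_diff)
  have c_eq: "c f = cochain_eval c (?D n (chain_boundary n (frag_of f)))" if "singular_simplex n X f" for f
  proof -
    have D: "singular_chain (Suc n) X (?D (Suc n) (frag_of f))"
        "small_chain n X \<C> (frag_of f - ?D n (chain_boundary n (frag_of f)) - chain_boundary (Suc n) (?D (Suc n) (frag_of f)))"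
      using small_homotopy[OF deform, of n "frag_of f"] that by (auto simp: singular_chain_of)
    from eval_small[OF D(2)] cocycle_eval_boundary[OF c D(1)] show ?thesis
      by (simp add: cochain_eval_diff)
  qed
  have c_cochain: "c f = 0" if "\<not> singular_simplex n X f" for f
    using c that by (auto simp: cocycles_def cochains_def)
  show ?thesis
  proof (cases n)
    case 0
    then have "c = (\<lambda>f. 0)"
      using c_eq c_cochain by (auto simp: fun_eq_iff)
    then show ?thesis
      by (simp add: coboundaries_zero)
  next
    case (Suc m)
    \<comment> \<open>In degree 0 the homotopy term was zero and c itself had to vanish; from degree
      1 on, c composed with the homotopy is a primitive.\<close>
    define e where "e = (\<lambda>g. if singular_simplex m X g then cochain_eval c (?D n (frag_of g)) else 0)"
    have "cochain_eval e x = cochain_eval c (?D n x)" if "singular_chain m X x" for x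
      using that unfolding singular_chain_def
      by (induction x rule: frag_induction) (auto simp: e_def cochain_eval_diff small_homotopy_diff)
    then have "coboundary m X e f = c f" if "singular_simplex n X f" for f
      using that c_eq[OF that] singular_chain_boundary_alt[of m X "frag_of f"]
      by (simp add: Suc coboundary_eq_eval singular_chain_of)
    then have "coboundary m X e = c"
      using c_cochain by (auto simp: fun_eq_iff coboundary_def Suc)
    moreover have "e \<in> cochains m X"
      by (simp add: e_def cochains_def)
    ultimately show ?thesis
      by (auto simp: Suc)
  qed
qed

text \<open>An iterated subdivision of z is small, and it differs from z by a boundary and a term
  built from the boundary of z, which is small already.\<close>

lemma small_deformation_open_cover:
  assumes \<C>: "\<And>U. U \<in> \<C> \<Longrightarrow> openin X U" "topspace X \<subseteq> \<Union>\<C>"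
    and z: "singular_chain p X z" "small_chain (p - Suc 0) X \<C> (chain_boundary p z)"
  shows "\<exists>y. singular_chain (Suc p) X y \<and> small_chain p X \<C> (z - chain_boundary (Suc p) y)"
proof -
  have "\<exists>n. \<forall>f \<in> Poly_Mapping.keys ((singular_subdivision p ^^ n) z). \<exists>V \<in> \<C>. f \<in> standard_simplex p \<rightarrow> V"
    by (rule sufficient_iterated_singular_subdivision_exists[OF \<C> z(1)]) blast+
  then obtain n where n: "\<forall>f \<in> Poly_Mapping.keys ((singular_subdivision p ^^ n) z). \<exists>V \<in> \<C>. f \<in> standard_simplex p \<rightarrow> V"
    by blast
  have "singular_chain p X ((singular_subdivision p ^^ m) z)" for m
    by (induction m) (auto simp: singular_chain_singular_subdivision z(1))
  then have sub: "small_chain p X \<C> ((singular_subdivision p ^^ n) z)"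
    using n unfolding small_chain_def by (simp add: Pi_iff image_subset_iff) 
  obtain h :: "nat \<Rightarrow> 'a chain \<Rightarrow> 'a chain" where h: "\<And>p. h p 0 = 0"
        "\<And>p c1 c2. h p (c1-c2) = h p c1 - h p c2"
        "\<And>p X c. singular_chain p X c \<Longrightarrow> singular_chain (Suc p) X (h p c)"
        "\<And>p X c. singular_chain p X c
                 \<Longrightarrow> chain_boundary (Suc p) (h p c) + h (p - Suc 0) (chain_boundary p c)
                   = (singular_subdivision p ^^ n) c - c"
    by (blast intro: chain_homotopic_iterated_singular_subdivision)
  \<comment> \<open>The properties of \<open>h\<close> hold in every space, hence in
    \<open>subtopology X V\<close>: a simplex inside V is sent to a chain inside V.\<close>
  have small_h: "small_chain (Suc q) X \<C> (h q x)" if "small_chain q X \<C> x" for q x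
    using that
  proof (induction x rule: small_chain_induct)
    case (one f V)
    then show ?case
      by (intro small_chain_subtopology[OF one(1)] h(3)) (simp add: singular_chain_of)
  qed (auto simp: h(1,2) small_chain_diff)
  have bd: "small_chain p X \<C> (h (p - Suc 0) (chain_boundary p z))"
  proof (cases p)
    case 0
    then show ?thesis by (simp add: chain_boundary_def h(1))
  next
    case (Suc q)
    then show ?thesis using small_h[OF z(2)] by simp
  qed
  have "z - chain_boundary (Suc p) (- h p z) = (singular_subdivision p ^^ n) z - h (p - Suc 0) (chain_boundary p z)"
    using h(4)[OF z(1)] by (simp add: chain_boundary_minus algebra_simps)
  then show ?thesis
    using small_chain_diff[OF sub bd] h(3)[OF z(1)]
    by (intro exI[of _ "- h p z"]) (simp add: singular_chain_minus)
qed

text \<open>Homotopy invariance for the pair of X and the point b: a chain with small boundary is a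
  relative cycle, hence homologous to its image under the constant map. This is why the homotopy has
  to fix b.\<close>

lemma small_deformation_point:
  assumes hom: "homotopic_with (\<lambda>h. h b = b) X X id (\<lambda>_. b)"
    and z: "singular_chain p X z" "small_chain (p - Suc 0) X {{b}} (chain_boundary p z)"
  shows "\<exists>y. singular_chain (Suc p) X y \<and> small_chain p X {{b}} (z - chain_boundary (Suc p) y)"
proof -
  have small: "small_chain q X {{b}} x \<longleftrightarrow> singular_chain q (subtopology X {b}) x" for q x
    by (auto simp: small_chain_def singular_chain_subtopology)
  have b: "b \<in> topspace X" if "z \<noteq> 0"
  proof -
    have "topspace X \<noteq> {}"
      using that z singular_chain_empty by blast
    then show ?thesis
      using homotopic_with_imp_continuous_maps[OF hom] by (auto simp: continuous_map_def)
  qed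
  have "homologous_rel p X {b} (chain_map p id z) (chain_map p (\<lambda>_. b) z)"
  proof (rule homotopic_imp_homologous_rel_chain_maps)
    show "homotopic_with (\<lambda>h. h \<in> {b} \<rightarrow> {b}) X X id (\<lambda>_. b)"
      using hom by (rule homotopic_with_mono) auto
    show "singular_relcycle p X {b} z"
      using z by (simp add: singular_relcycle small)
  qed
  then obtain y e where y: "singular_chain (Suc p) X y" "singular_chain p (subtopology X {b}) e"
      and eq: "chain_boundary (Suc p) y + e = z - chain_map p (\<lambda>_. b) z"
    using chain_map_ident[OF z(1)] by (auto simp: homologous_rel_def singular_relboundary)
  have const: "singular_chain p (subtopology X {b}) (chain_map p (\<lambda>_. b) z)"
  proof (cases "z = 0")
    case False
    then show ?thesis
      using b z by (intro singular_chain_chain_map[of p X]) (auto simp: continuous_map_in_subtopology)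
  qed simp
  have "z - chain_boundary (Suc p) y = e + chain_map p (\<lambda>_. b) z"
    using eq by (simp add: algebra_simps)
  then show ?thesis
    using y const by (auto simp: small singular_chain_add)
qed

section \<open>Vanishing of cohomology\<close>

lemma cocycle_vanishing_on_open_cover:
  fixes c :: "('a, 'r::comm_ring_1) cochain"
  assumes "\<And>U. U \<in> \<C> \<Longrightarrow> openin X U" "topspace X \<subseteq> \<Union>\<C>"
    and "c \<in> cocycles n X"
    and "\<And>V f. V \<in> \<C> \<Longrightarrow> singular_simplex n (subtopology X V) f \<Longrightarrow> c f = 0"
  shows "c \<in> coboundaries n X"
  using assms by (intro cocycle_vanishing_on_small[of X \<C>] small_deformation_open_cover)

section \<open>Restriction of cochains to subspaces\<close>

lemma cochains_subtopology: "cochains q (subtopology X A) \<subseteq> cochains q X"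
  by (auto simp: cochains_def singular_simplex_subtopology)

lemma cochain_restrict_in_cochains: "cochain_restrict q X A c \<in> cochains q (subtopology X A)"
  by (simp add: cochains_def cochain_restrict_def)

lemma coboundary_cochain_restrict:
  "coboundary q (subtopology X A) (cochain_restrict q X A c) = cochain_restrict (Suc q) X A (coboundary q X c)"
proof
  fix f
  have "singular_simplex q (subtopology X A) (singular_face (Suc q) k f)"
    if "singular_simplex (Suc q) (subtopology X A) f" "k \<le> Suc q" for k
    using singular_simplex_singular_face[OF that(1)] that(2) by simp
  then show "coboundary q (subtopology X A) (cochain_restrict q X A c) f = cochain_restrict (Suc q) X A (coboundary q X c) f"
    by (auto simp: coboundary_def cochain_restrict_def singular_simplex_subtopology simp del: sum.atMost_Suc
        intro!: sum.cong)
qed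

lemma coboundary_subtopology:
  assumes "singular_simplex (Suc q) (subtopology X A) f"
  shows "coboundary q (subtopology X A) c f = coboundary q X c f"
  using assms by (simp add: coboundary_def singular_simplex_subtopology)

lemma cocycles_cochain_restrict:
  assumes "c \<in> cocycles q X"
  shows "cochain_restrict q X A c \<in> cocycles q (subtopology X A)"
  using assms
  by (simp add: cocycles_def cochain_restrict_in_cochains coboundary_cochain_restrict)
     (simp add: cochain_restrict_def)

lemma cochain_restrict_restrict:
  "A \<subseteq> B \<Longrightarrow> cochain_restrict q (subtopology X B) A (cochain_restrict q X B c) = cochain_restrict q X A c"
  by (auto simp: cochain_restrict_def fun_eq_iff singular_simplex_subtopology)

lemma coboundaries_cochain_restrict:
  assumes "c \<in> coboundaries q X"
  shows "cochain_restrict q X A c \<in> coboundaries q (subtopology X A)"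
proof (cases q)
  case 0
  then show ?thesis
    using assms by (auto simp: cochain_restrict_def)
next
  case (Suc p)
  then show ?thesis
    using assms by (auto simp: cochain_restrict_in_cochains simp flip: coboundary_cochain_restrict)
qed

lemma coboundaries_cochain_restrict_mono:
  assumes "cochain_restrict q X B c \<in> coboundaries q (subtopology X B)" "A \<subseteq> B"
  shows "cochain_restrict q X A c \<in> coboundaries q (subtopology X A)"
  using coboundaries_cochain_restrict[OF assms(1), of A] assms(2)
  by (simp add: cochain_restrict_restrict subtopology_subtopology Int_absorb1)

text \<open>By the normalization, a primitive on A is already a cochain on X, and its coboundary in
  X has the right values on the simplices of A.\<close>

lemma coboundary_extends:
  assumes "cochain_restrict q X A c \<in> coboundaries q (subtopology X A)"
  shows "\<exists>d\<in>coboundaries q X. \<forall>f. singular_simplex q (subtopology X A) f \<longrightarrow> c f = d f"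
proof (cases q)
  case 0
  have "cochain_restrict q X A c f = 0" for f
    using assms by (simp add: 0)
  then have "\<forall>f. singular_simplex q (subtopology X A) f \<longrightarrow> c f = 0"
    by (metis cochain_restrict_def)
  then show ?thesis
    by (intro bexI[OF _ coboundaries_zero]) auto
next
  case (Suc p)
  with assms obtain e where e: "e \<in> cochains p (subtopology X A)"
      "cochain_restrict q X A c = coboundary p (subtopology X A) e"
    by auto
  have "c f = coboundary p X e f" if "singular_simplex q (subtopology X A) f" for f
    using that fun_cong[OF e(2), of f] coboundary_subtopology[of p X A f e]
    by (simp add: cochain_restrict_def Suc)
  moreover have "coboundary p X e \<in> coboundaries q X"
    using subsetD[OF cochains_subtopology e(1)] by (simp add: Suc)
  ultimately show ?thesis
    by blast
qed

lemma cocycle_extends: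
  fixes c :: "('a, 'r::comm_ring_1) cochain"
  assumes "cocycles q (subtopology X A) \<subseteq> (coboundaries q (subtopology X A) :: ('a, 'r) cochain set)"
    and "c \<in> cocycles q X"
  shows "\<exists>d\<in>coboundaries q X. \<forall>f. singular_simplex q (subtopology X A) f \<longrightarrow> c f = d f"
  using assms cocycles_cochain_restrict by (intro coboundary_extends) blast

lemma cocycles_empty:
  assumes "topspace X = {}"
  shows "cocycles q X \<subseteq> coboundaries q X"
  using assms coboundaries_zero by (auto simp: cocycles_def cochains_def singular_simplex_empty simp flip: fun_eq_iff)

text \<open>The image of a simplex is connected and nonempty, so it cannot meet both one piece and
  the union of the others.\<close>

lemma singular_simplex_subtopology_UnD:
  assumes "\<And>i. i \<in> I \<Longrightarrow> openin X (W i)" "pairwise (\<lambda>i j. disjnt (W i) (W j)) I"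
    and f: "singular_simplex q (subtopology X (\<Union>i\<in>I. W i)) f"
  obtains i where "i \<in> I" "singular_simplex q (subtopology X (W i)) f"
proof -
  obtain x where x: "x \<in> standard_simplex q"
    using nonempty_standard_simplex by blast
  have fX: "singular_simplex q X f" and im: "f ` standard_simplex q \<subseteq> (\<Union>i\<in>I. W i)"
    using f by (auto simp: singular_simplex_subtopology)
  have conn: "connectedin X (f ` standard_simplex q)"
  proof (rule connectedin_continuous_map_image)
    show "continuous_map (subtopology (powertop_real UNIV) (standard_simplex q)) X f"
      using fX by (simp add: singular_simplex_def)
    show "connectedin (subtopology (powertop_real UNIV) (standard_simplex q)) (standard_simplex q)"
      using connectedin_standard_simplex by (simp add: connectedin_subtopology)
  qed
  obtain i where i: "i \<in> I" "f x \<in> W i"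
    using im x by blast
  let ?V = "\<Union>j\<in>I - {i}. W j"
  have "openin X ?V"
    using assms(1) by blast
  moreover have "W i \<inter> ?V = {}"
    using assms(2) i(1) by (fastforce simp: pairwise_def disjnt_def)
  moreover have "f ` standard_simplex q \<subseteq> W i \<union> ?V" "W i \<inter> f ` standard_simplex q \<noteq> {}"
    using im i x by blast+
  ultimately have "?V \<inter> f ` standard_simplex q = {}"
    using conn assms(1)[OF i(1)] unfolding connectedin by blast
  then have "f ` standard_simplex q \<subseteq> W i"
    using im by blast
  then show ?thesis
    using that i fX by (simp add: singular_simplex_subtopology)
qed

text \<open>Primitives chosen on the pieces can be glued, since all faces of a simplex lie in the
  same piece as the simplex.\<close>

lemma cohomology_vanishes_disjoint_union:
  fixes X :: "'a topology"
  assumes op: "\<And>i. i \<in> I \<Longrightarrow> openin X (W i)" and disj: "pairwise (\<lambda>i j. disjnt (W i) (W j)) I"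
    and van: "\<And>i. i \<in> I \<Longrightarrow> cocycles q (subtopology X (W i)) \<subseteq> (coboundaries q (subtopology X (W i)) :: ('a, 'r::comm_ring_1) cochain set)"
  shows "cocycles q (subtopology X (\<Union>i\<in>I. W i)) \<subseteq> (coboundaries q (subtopology X (\<Union>i\<in>I. W i)) :: ('a, 'r::comm_ring_1) cochain set)"
proof
  let ?Y = "subtopology X (\<Union>i\<in>I. W i)"
  have sub: "subtopology ?Y (W i) = subtopology X (W i)" if "i \<in> I" for i
    using that by (simp add: subtopology_subtopology Int_absorb1 UN_upper)
  fix c :: "('a, 'r) cochain"
  assume c: "c \<in> cocycles q ?Y"
  have "\<exists>d. d \<in> coboundaries q ?Y \<and> (\<forall>f. singular_simplex q (subtopology X (W i)) f \<longrightarrow> c f = d f)" if "i \<in> I" for i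
    using cocycle_extends[OF _ c, of "W i"] van[OF that] unfolding sub[OF that] by blast
  then obtain d where d: "\<And>i. i \<in> I \<Longrightarrow> d i \<in> coboundaries q ?Y"
      "\<And>i f. i \<in> I \<Longrightarrow> singular_simplex q (subtopology X (W i)) f \<Longrightarrow> c f = d i f"
    by metis
  show "c \<in> coboundaries q ?Y"
  proof (cases q)
    case 0
    have "c f = 0" for f
    proof (cases "singular_simplex q ?Y f")
      case True
      then show ?thesis
        using singular_simplex_subtopology_UnD[OF op disj] d 0 by (metis coboundaries.simps(1) singletonD)
    qed (use c in \<open>auto simp: cocycles_def cochains_def\<close>)
    then have "c = (\<lambda>f. 0)"
      by auto
    then show ?thesis
      by (simp only: coboundaries_zero)
  next
    case (Suc p)
    obtain e where e: "\<And>i. i \<in> I \<Longrightarrow> d i = coboundary p ?Y (e i)"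
      using d(1) by (simp add: Suc image_iff) metis
    \<comment> \<open>The choice is forced: any point of the image of the simplex determines the
      piece.\<close>
    define piece where "piece = (\<lambda>f. SOME i. i \<in> I \<and> singular_simplex p (subtopology X (W i)) f)"
    define g where "g = (\<lambda>f. if singular_simplex p ?Y f then e (piece f) f else 0)"
    have piece: "piece f = i" if "i \<in> I" "singular_simplex p (subtopology X (W i)) f" for i f
      unfolding piece_def
    proof (rule some_equality)
      fix j
      assume j: "j \<in> I \<and> singular_simplex p (subtopology X (W j)) f"
      obtain x where "x \<in> standard_simplex p"
        using nonempty_standard_simplex by blast
      then have "f x \<in> W i \<inter> W j"
        using j that by (auto simp: singular_simplex_subtopology)
      then show "j = i"
        using disj j that by (auto simp: pairwise_def disjnt_def)
    qed (use that in auto)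
    have "coboundary p ?Y g f = c f" for f
    proof (cases "singular_simplex q ?Y f")
      case True
      then obtain i where i: "i \<in> I" "singular_simplex q (subtopology X (W i)) f"
        using singular_simplex_subtopology_UnD[OF op disj] by metis
      have "g (singular_face (Suc p) k f) = e i (singular_face (Suc p) k f)" if "k \<le> Suc p" for k
      proof -
        have "singular_simplex p (subtopology X (W i)) (singular_face (Suc p) k f)"
          using singular_simplex_singular_face[of q "subtopology X (W i)" f k] i that by (simp add: Suc)
        then show ?thesis
          using piece[OF i(1)] singular_simplex_mono[of p X "W i" _ "\<Union>i\<in>I. W i"] i(1) by (auto simp: g_def)
      qed
      then have "coboundary p ?Y g f = coboundary p ?Y (e i) f"
        by (simp add: coboundary_def del: sum.atMost_Suc)
      then show ?thesis
        using d(2)[OF i] e[OF i(1)] by simp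
    qed (use c in \<open>auto simp: cocycles_def cochains_def coboundary_def Suc\<close>)
    then have "c = coboundary p ?Y g"
      by auto
    then show ?thesis
      by (auto simp: Suc g_def cochains_def)
  qed
qed

text \<open>Primitives a on U and b on V differ on the intersection by a cocycle of degree q, hence
  by the restriction of a coboundary d; since d is closed, b + d serves on V as well and agrees with
  a on the intersection.\<close>

lemma cohomology_vanishes_Mayer_Vietoris:
  fixes X :: "'a topology"
  assumes U: "openin X U" and V: "openin X V" and UV: "U \<union> V = topspace X"
    and vU: "cocycles (Suc q) (subtopology X U) \<subseteq> (coboundaries (Suc q) (subtopology X U) :: ('a, 'r::comm_ring_1) cochain set)"
    and vV: "cocycles (Suc q) (subtopology X V) \<subseteq> (coboundaries (Suc q) (subtopology X V) :: ('a, 'r) cochain set)"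
    and vUV: "cocycles q (subtopology X (U \<inter> V)) \<subseteq> (coboundaries q (subtopology X (U \<inter> V)) :: ('a, 'r) cochain set)"
  shows "cocycles (Suc q) X \<subseteq> (coboundaries (Suc q) X :: ('a, 'r) cochain set)"
proof
  fix c :: "('a, 'r) cochain"
  assume c: "c \<in> cocycles (Suc q) X"
  obtain a where a: "\<And>f. singular_simplex (Suc q) (subtopology X U) f \<Longrightarrow> c f = coboundary q X a f"
    using cocycle_extends[OF vU c] by auto
  obtain b where b: "\<And>f. singular_simplex (Suc q) (subtopology X V) f \<Longrightarrow> c f = coboundary q X b f"
    using cocycle_extends[OF vV c] by auto
  let ?ab = "\<lambda>f. a f - b f"
  have "cochain_restrict (Suc q) X (U \<inter> V) (coboundary q X ?ab) = (\<lambda>\<sigma>. 0)"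
  proof
    fix f
    show "cochain_restrict (Suc q) X (U \<inter> V) (coboundary q X ?ab) f = 0"
    proof (cases "singular_simplex (Suc q) (subtopology X (U \<inter> V)) f")
      case True
      then have "singular_simplex (Suc q) (subtopology X U) f" "singular_simplex (Suc q) (subtopology X V) f"
        by (auto simp: singular_simplex_subtopology)
      then show ?thesis
        using True by (simp add: cochain_restrict_def coboundary_diff flip: a b)
    qed (simp add: cochain_restrict_def)
  qed
  then have "cochain_restrict q X (U \<inter> V) ?ab \<in> cocycles q (subtopology X (U \<inter> V))"
    by (simp add: cocycles_def cochain_restrict_in_cochains coboundary_cochain_restrict)
  then obtain d where d: "d \<in> coboundaries q X" "\<And>f. singular_simplex q (subtopology X (U \<inter> V)) f \<Longrightarrow> a f - b f = d f"
    using subsetD[OF vUV, THEN coboundary_extends] by blast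
  have dd: "coboundary q X d = (\<lambda>\<sigma>. 0)"
    using d(1) coboundaries_subset_cocycles by (auto simp: cocycles_def)
  \<comment> \<open>Simplices inside neither set get the value 0, so g need not be a primitive of c;
    but c minus its coboundary is zero on all simplices inside U or V, hence a coboundary.\<close>
  define g where "g = (\<lambda>f. if singular_simplex q (subtopology X U) f then a f
      else if singular_simplex q (subtopology X V) f then b f + d f else 0)"
  have gU: "coboundary q X g f = coboundary q X a f" if "singular_simplex (Suc q) (subtopology X U) f" for f
  proof -
    have "g (singular_face (Suc q) k f) = a (singular_face (Suc q) k f)" if "k \<le> Suc q" for k
      using singular_simplex_singular_face[of "Suc q" "subtopology X U" f k] that \<open>singular_simplex (Suc q) (subtopology X U) f\<close>
      by (simp add: g_def)
    then show ?thesis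
      by (simp add: coboundary_def del: sum.atMost_Suc)
  qed
  have gV: "coboundary q X g f = coboundary q X (\<lambda>f. b f + d f) f" if "singular_simplex (Suc q) (subtopology X V) f" for f
  proof -
    have "g (singular_face (Suc q) k f) = b (singular_face (Suc q) k f) + d (singular_face (Suc q) k f)" if "k \<le> Suc q" for k
    proof -
      have *: "singular_simplex q (subtopology X V) (singular_face (Suc q) k f)"
        using singular_simplex_singular_face[of "Suc q" "subtopology X V" f k] that \<open>singular_simplex (Suc q) (subtopology X V) f\<close>
        by simp
      show ?thesis
        using * d(2)[of "singular_face (Suc q) k f"]
        by (auto simp: g_def singular_simplex_subtopology algebra_simps)
    qed
    then show ?thesis
      by (simp add: coboundary_def del: sum.atMost_Suc)
  qed
  have g: "g \<in> cochains q X"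
    by (auto simp: g_def cochains_def singular_simplex_subtopology)
  have "(\<lambda>f. c f - coboundary q X g f) \<in> coboundaries (Suc q) X"
  proof (rule cocycle_vanishing_on_open_cover[of "{U, V}"])
    show "(\<lambda>f. c f - coboundary q X g f) \<in> cocycles (Suc q) X"
      using c g by (intro cocycles_diff) (auto intro: subsetD[OF coboundaries_subset_cocycles])
    show "c f - coboundary q X g f = 0" if "W \<in> {U, V}" "singular_simplex (Suc q) (subtopology X W) f" for W f
      using that a b gU gV by (auto simp: coboundary_add dd)
  qed (use U V UV in auto)
  from coboundaries_add[OF this, of "coboundary q X g"] g show "c \<in> coboundaries (Suc q) X"
    by auto
qed

text \<open>Induction on the number of sets: Mayer-Vietoris trades one set for one degree.\<close>

lemma cohomology_vanishes_good_cover: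
  fixes X :: "'a topology"
  assumes "finite C" "\<And>i. i \<in> C \<Longrightarrow> openin X (G i)"
    and "\<And>D p. D \<subseteq> C \<Longrightarrow> D \<noteq> {} \<Longrightarrow>
      cocycles (Suc p) (subtopology X (\<Inter>i\<in>D. G i)) \<subseteq> (coboundaries (Suc p) (subtopology X (\<Inter>i\<in>D. G i)) :: ('a, 'r::comm_ring_1) cochain set)"
    and "card C \<le> q"
  shows "cocycles q (subtopology X (\<Union>i\<in>C. G i)) \<subseteq> (coboundaries q (subtopology X (\<Union>i\<in>C. G i)) :: ('a, 'r) cochain set)"
  using assms
proof (induction C arbitrary: G q rule: finite_induct)
  case empty
  then show ?case
    by (intro cocycles_empty) simp
next
  case (insert j C)
  \<comment> \<open>The bound by q keeps the degree positive while a set is left. Degree 0 can occur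
    only for the empty union, so the intersections need to be acyclic in positive degrees
    only.\<close>
  then obtain p where q: "q = Suc p" and p: "card C \<le> p"
    by (cases q) auto
  let ?Y = "subtopology X (\<Union>i\<in>insert j C. G i)"
  let ?U = "\<Union>i\<in>C. G i"
  have eq: "subtopology ?Y ?U = subtopology X ?U" "subtopology ?Y (G j) = subtopology X (G j)"
      "subtopology ?Y (?U \<inter> G j) = subtopology X (\<Union>i\<in>C. G i \<inter> G j)"
    by (auto simp: subtopology_subtopology intro: arg_cong[where f = "subtopology X"])
  show ?case
    unfolding q
  proof (rule cohomology_vanishes_Mayer_Vietoris[of ?Y ?U "G j"], unfold eq)
    have "openin X (\<Union>i\<in>insert j C. G i)" "openin X ?U" "openin X (G j)"
      using insert.prems(1) by blast+
    then show "openin ?Y ?U" "openin ?Y (G j)"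
      by (auto simp: openin_open_subtopology)
    show "?U \<union> G j = topspace ?Y"
      using insert.prems(1) openin_subset by fastforce
    show "cocycles (Suc p) (subtopology X ?U) \<subseteq> (coboundaries (Suc p) (subtopology X ?U) :: ('a, 'r) cochain set)"
      using insert.prems p by (intro insert.IH) auto
    show "cocycles (Suc p) (subtopology X (G j)) \<subseteq> (coboundaries (Suc p) (subtopology X (G j)) :: ('a, 'r) cochain set)"
      using insert.prems(2)[of "{j}"] by auto
    \<comment> \<open>The intersection with \<open>G j\<close> is covered by the sets
      \<open>G i \<inter> G j\<close>, one set fewer in one degree less, and their intersections are
      again intersections of the original family.\<close>
    have "cocycles p (subtopology X (\<Union>i\<in>C. G i \<inter> G j)) \<subseteq> (coboundaries p (subtopology X (\<Union>i\<in>C. G i \<inter> G j)) :: ('a, 'r) cochain set)"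
    proof (rule insert.IH[where G = "\<lambda>i. G i \<inter> G j"])
      fix D p'
      assume D: "D \<subseteq> C" "D \<noteq> {}"
      have eq: "(\<Inter>i\<in>D. G i \<inter> G j) = (\<Inter>i\<in>insert j D. G i)"
        using D by auto
      show "cocycles (Suc p') (subtopology X (\<Inter>i\<in>D. G i \<inter> G j)) \<subseteq>
          (coboundaries (Suc p') (subtopology X (\<Inter>i\<in>D. G i \<inter> G j)) :: ('a, 'r) cochain set)"
        unfolding eq using D by (intro insert.prems(2)) auto
    qed (use insert.prems p in auto)
    then show "cocycles p (subtopology X (\<Union>i\<in>C. G i \<inter> G j)) \<subseteq> (coboundaries p (subtopology X (\<Union>i\<in>C. G i \<inter> G j)) :: ('a, 'r) cochain set)" .
  qed
qed

text \<open>The restriction of c to the point b is a coboundary by direct computation. After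
  subtracting an extension of it, c is zero on the simplices at b, and chains deform to b.\<close>

lemma cohomology_vanishes_contractible:
  fixes X :: "'a topology"
  assumes hom: "homotopic_with (\<lambda>h. h b = b) X X id (\<lambda>_. b)" and b: "b \<in> topspace X"
  shows "cocycles (Suc q) X \<subseteq> (coboundaries (Suc q) X :: ('a, 'r::comm_ring_1) cochain set)"
proof
  fix c :: "('a, 'r) cochain"
  assume c: "c \<in> cocycles (Suc q) X"
  let ?B = "subtopology X {b}"
  have tB: "topspace ?B = {b}"
    using b by auto
  define s where "s = (\<lambda>p. restrict (\<lambda>x :: nat \<Rightarrow> real. b) (standard_simplex p))"
  have B: "singular_simplex p ?B f \<longleftrightarrow> f = s p" for p f
    using singular_simplex_singleton[OF tB] by (simp add: s_def)
  have face: "singular_face (Suc p) k (s (Suc p)) = s p" if "k \<le> Suc p" for p k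
    using singular_simplex_singular_face[of "Suc p" ?B "s (Suc p)" k] that by (simp add: B)
  have alt: "(\<Sum>k\<le>n. (-1) ^ k :: 'r) = (if even n then 1 else 0)" for n :: nat
    by (induction n) auto
  \<comment> \<open>A point has one simplex in each degree, and its p + 2 faces coincide, so the
    alternating sum is 1 for odd p and 0 for even p.\<close>
  have cob: "coboundary p ?B e = (\<lambda>f. if f = s (Suc p) \<and> odd p then e (s p) else 0)" for p and e :: "('a, 'r) cochain"
    using alt[of "Suc p"]
    by (intro ext) (simp add: coboundary_def B face del: sum.atMost_Suc flip: sum_distrib_right)
  let ?cB = "cochain_restrict (Suc q) X {b} c"
  have cB: "?cB \<in> cochains (Suc q) ?B" "coboundary (Suc q) ?B ?cB = (\<lambda>f. 0)"
    using cocycles_cochain_restrict[OF c, of "{b}"] by (auto simp: cocycles_def)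
  have "?cB \<in> coboundaries (Suc q) ?B"
  \<comment> \<open>For odd q the coboundary into degree q + 1 is onto; for even q the one leaving
    degree q + 1 is injective, so the cocycle is zero.\<close>
  proof (cases "odd q")
    case True
    define e where "e = (\<lambda>f. if f = s q then ?cB (s (Suc q)) else 0)"
    have "?cB = coboundary q ?B e"
      using cB(1) True by (intro ext) (auto simp: cob e_def cochains_def B)
    moreover have "e \<in> cochains q ?B"
      by (auto simp: e_def cochains_def B)
    ultimately show ?thesis
      by auto
  next
    case False
    then have "?cB (s (Suc q)) = 0"
      using fun_cong[OF cB(2), of "s (Suc (Suc q))"] by (simp add: cob)
    then have "?cB f = 0" for f
      using cB(1) by (cases "f = s (Suc q)") (simp_all add: cochains_def B)
    then have "?cB = (\<lambda>f. 0)"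
      by (rule ext)
    then show ?thesis
      using coboundaries_zero by metis
  qed
  then obtain d where d: "d \<in> coboundaries (Suc q) X" "\<And>f. singular_simplex (Suc q) ?B f \<Longrightarrow> c f = d f"
    using coboundary_extends by blast
  have "(\<lambda>f. c f - d f) \<in> coboundaries (Suc q) X"
  proof (rule cocycle_vanishing_on_small[of X "{{b}}"])
    show "(\<lambda>f. c f - d f) \<in> cocycles (Suc q) X"
      using c d coboundaries_subset_cocycles by (blast intro: cocycles_diff)
  qed (use d small_deformation_point[OF hom] in auto)
  from coboundaries_add[OF this d(1)] show "c \<in> coboundaries (Suc q) X"
    by simp
qed

section \<open>Products of classes vanishing on an open cover\<close>

lemma cochain_cup_zero [simp]:
  "cochain_cup p q X (\<lambda>\<sigma>. 0) b = (\<lambda>\<sigma>. 0)" "cochain_cup p q X a (\<lambda>\<sigma>. 0) = (\<lambda>\<sigma>. 0)"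
  by (simp_all add: cochain_cup_def fun_eq_iff)

lemma cocycles_cochain_cup:
  assumes "a \<in> cocycles p X" "b \<in> cocycles q X"
  shows "cochain_cup p q X a b \<in> cocycles (p + q) X"
  using assms by (simp add: cocycles_def cochain_cup_in_cochains coboundary_cochain_cup)

lemma coboundaries_cochain_cup_left:
  assumes "a \<in> coboundaries p X" "b \<in> cocycles q X"
  shows "cochain_cup p q X a b \<in> coboundaries (p + q) X"
proof (cases p)
  case 0
  then show ?thesis
    using assms by (simp add: coboundaries_zero)
next
  case (Suc m)
  then obtain x where "a = coboundary m X x"
    using assms by auto
  then have "cochain_cup p q X a b = coboundary (m + q) X (cochain_cup m q X x b)"
    using assms(2) by (simp add: coboundary_cochain_cup cocycles_def Suc)
  then show ?thesis
    by (simp add: Suc cochain_cup_in_cochains)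
qed

lemma coboundaries_cochain_cup_right:
  assumes "a \<in> cocycles p X" "b \<in> coboundaries q X"
  shows "cochain_cup p q X a b \<in> coboundaries (p + q) X"
proof (cases q)
  case 0
  then show ?thesis
    using assms by (simp add: coboundaries_zero)
next
  case (Suc m)
  then obtain y where "b = coboundary m X y"
    using assms by auto
  then have "cochain_cup p q X a b = coboundary (p + m) X (\<lambda>f. (-1) ^ p * cochain_cup p m X a y f)"
    using assms(1)
    by (simp add: coboundary_cmul coboundary_cochain_cup cocycles_def Suc mult.assoc[symmetric] flip: power_add)
  moreover have "(\<lambda>f. (-1) ^ p * cochain_cup p m X a y f) \<in> cochains (p + m) X"
    by (simp add: cochains_def cochain_cup_def)
  ultimately show ?thesis
    by (simp add: Suc)
qed

text \<open>\<open>class_cup\<close> is a union over all representatives. It collapses to one class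
  because a'b' - ab = (a' - a)b' + a(b' - b).\<close>

lemma class_cup_class:
  assumes a: "a \<in> cocycles p X" and b: "b \<in> cocycles q X"
  shows "class_cup p q X (cohomology_class p X a) (cohomology_class q X b) = cohomology_class (p + q) X (cochain_cup p q X a b)"
proof -
  have "cohomology_class (p + q) X (cochain_cup p q X a' b') = cohomology_class (p + q) X (cochain_cup p q X a b)"
    if a': "a' \<in> cohomology_class p X a" and b': "b' \<in> cohomology_class q X b" for a' b'
  proof (rule cohomology_class_cong)
    have da: "(\<lambda>f. a' f - a f) \<in> coboundaries p X" and db: "(\<lambda>f. b' f - b f) \<in> coboundaries q X"
      using a' b' by (simp_all add: in_cohomology_class_iff)
    have b'c: "b' \<in> cocycles q X"
      using cocycles_add[OF subsetD[OF coboundaries_subset_cocycles db] b] by simp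
    have "(\<lambda>f. cochain_cup p q X a' b' f - cochain_cup p q X a b f) =
      (\<lambda>f. cochain_cup p q X (\<lambda>f. a' f - a f) b' f + cochain_cup p q X a (\<lambda>f. b' f - b f) f)"
      by (simp add: cochain_cup_def fun_eq_iff algebra_simps)
    then show "(\<lambda>f. cochain_cup p q X a' b' f - cochain_cup p q X a b f) \<in> coboundaries (p + q) X"
      using coboundaries_add[OF coboundaries_cochain_cup_left[OF da b'c] coboundaries_cochain_cup_right[OF a db]]
      by simp
  qed
  moreover have "a \<in> cohomology_class p X a" "b \<in> cohomology_class q X b"
    by (simp_all add: in_cohomology_class_iff coboundaries_zero)
  ultimately show ?thesis
    unfolding class_cup_def by blast
qed

text \<open>Bracketed like \<open>seq_product\<close>, so that it represents that class; on
  cochains, vanishing can be checked simplex by simplex.\<close>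

fun seq_cup :: "'a topology \<Rightarrow> (nat \<times> ('a, 'r::comm_ring_1) cochain) list \<Rightarrow> ('a, 'r) cochain" where
  "seq_cup X [] = (\<lambda>\<sigma>. if singular_simplex 0 X \<sigma> then 1 else 0)"
| "seq_cup X ((p, a) # t) = cochain_cup p (sum_list (map fst t)) X a (seq_cup X t)"

lemma cocycles_seq_cup:
  assumes "\<And>q a. (q, a) \<in> set t \<Longrightarrow> a \<in> cocycles q X"
  shows "seq_cup X t \<in> cocycles (sum_list (map fst t)) X"
  using assms
proof (induction t)
  case Nil
  have "coboundary 0 X (seq_cup X []) \<sigma> = 0" for \<sigma>
    using singular_simplex_singular_face[of "Suc 0" X \<sigma>] by (simp add: coboundary_def)
  then have "coboundary 0 X (seq_cup X []) = (\<lambda>\<sigma>. 0)"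
    by (rule ext)
  then show ?case
    by (simp add: cocycles_def cochains_def)
next
  case (Cons u t)
  then show ?case
    by (cases u) (auto intro: cocycles_cochain_cup)
qed

lemma seq_product_class:
  assumes "\<And>q a. (q, a) \<in> set t \<Longrightarrow> a \<in> cocycles q X"
  shows "seq_product X (map (\<lambda>(q, a). (q, cohomology_class q X a)) t) =
    (sum_list (map fst t), cohomology_class (sum_list (map fst t)) X (seq_cup X t))"
  using assms
proof (induction t)
  case Nil
  then show ?case
    by (simp add: unit_class_def)
next
  case (Cons u t)
  then show ?case
    using cocycles_seq_cup[of t X] by (cases u) (simp add: class_cup_class)
qed

text \<open>Front and back faces of a simplex in V stay in V, so every factor is evaluated on
  simplices of V and one vanishing factor is enough, wherever it stands.\<close>

lemma seq_cup_vanishes: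
  assumes "(q, a) \<in> set t" "\<And>f. singular_simplex q (subtopology X V) f \<Longrightarrow> a f = 0"
    and "singular_simplex (sum_list (map fst t)) (subtopology X V) f"
  shows "seq_cup X t f = 0"
  using assms(1,3)
proof (induction t arbitrary: f)
  case (Cons u t)
  obtain p b where u: "u = (p, b)"
    by force
  let ?n = "sum_list (map fst t)"
  have f: "singular_simplex (p + ?n) (subtopology X V) f"
    using Cons.prems by (simp add: u)
  show ?case
    using Cons.prems(1) Cons.IH[OF _ singular_simplex_back_face[OF f]] assms(2) singular_simplex_front_face[OF f]
    by (auto simp: u cochain_cup_def)
qed simp

text \<open>Phrased through a representative on X, since the product argument modifies
  representatives. It is the common form of vanishing by weight and by degree.\<close>

definition vanishes_on :: "'a topology \<Rightarrow> 'a set \<Rightarrow> ('a, 'r::comm_ring_1) homogeneous \<Rightarrow> bool" where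
  "vanishes_on X A u \<longleftrightarrow> (\<exists>z\<in>cocycles (fst u) X. snd u = cohomology_class (fst u) X z \<and>
     cochain_restrict (fst u) X A z \<in> coboundaries (fst u) (subtopology X A))"

lemma vanishes_on_mono: "vanishes_on X B u \<Longrightarrow> A \<subseteq> B \<Longrightarrow> vanishes_on X A u"
  unfolding vanishes_on_def using coboundaries_cochain_restrict_mono by blast

lemma vanishes_on_hrestrict:
  assumes "snd u \<in> carrier (cohomology_group (fst u) X)" "is_zero (subtopology X A) (hrestrict X A u)"
  shows "vanishes_on X A u"
proof -
  obtain q c where u: "u = (q, c)"
    by force
  obtain z where z: "z \<in> cocycles q X" "c = cohomology_class q X z"
    using assms(1) by (auto simp: u carrier_cohomology_group)
  have "z \<in> c"
    by (simp add: z in_cohomology_class_iff coboundaries_zero)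
  moreover have "cochain_restrict q X A z \<in> cohomology_class q (subtopology X A) (cochain_restrict q X A z)"
    by (simp add: in_cohomology_class_iff coboundaries_zero)
  ultimately have "cochain_restrict q X A z \<in> class_restrict q X A c"
    by (auto simp: class_restrict_def)
  then show ?thesis
    using z assms(2) by (auto simp: vanishes_on_def u hrestrict_def is_zero_iff)
qed

lemma vanishes_on_cohomology_vanishes:
  fixes u :: "('a, 'r::comm_ring_1) homogeneous"
  assumes "snd u \<in> carrier (cohomology_group (fst u) X)"
    and "cocycles (fst u) (subtopology X A) \<subseteq> (coboundaries (fst u) (subtopology X A) :: ('a, 'r) cochain set)"
  shows "vanishes_on X A u"
  using assms cocycles_cochain_restrict[of _ "fst u" X A]
  by (fastforce simp: vanishes_on_def carrier_cohomology_group)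

text \<open>A weight estimator promises nothing about zero classes; entries of this kind are covered
  here.\<close>

lemma vanishes_on_is_zero:
  fixes u :: "('a, 'r::comm_ring_1) homogeneous"
  assumes "is_zero X u"
  shows "vanishes_on X A u"
proof -
  have "cohomology_class (fst u) X (\<lambda>f. 0 :: 'r) = coboundaries (fst u) X"
    using is_zero_class_iff[of X "fst u" "\<lambda>f. 0 :: 'r"] coboundaries_zero[of "fst u" X]
    unfolding is_zero_iff by blast
  then have "snd u = cohomology_class (fst u) X (\<lambda>f. 0 :: 'r)"
    using assms is_zero_iff[of X "fst u" "snd u"] by simp
  moreover have "cochain_restrict (fst u) X A (\<lambda>f. 0 :: 'r) = (\<lambda>f. 0)"
    by (simp add: cochain_restrict_def)
  ultimately show ?thesis
    unfolding vanishes_on_def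
    using coboundaries_zero[of "fst u" X] coboundaries_zero[of "fst u" "subtopology X A"] coboundaries_subset_cocycles
    by (intro bexI[of _ "\<lambda>f. 0"] conjI) auto
qed

text \<open>Representatives vanishing on the sets of the cover have a cochain product that vanishes on
  all simplices that are small with respect to the cover.\<close>

lemma seq_product_zero:
  fixes s :: "('a, 'r::comm_ring_1) homogeneous list"
  assumes op: "\<And>i. i < length s \<Longrightarrow> openin X (U i)"
    and cover: "topspace X \<subseteq> (\<Union>i<length s. U i)"
    and van: "\<And>i. i < length s \<Longrightarrow> vanishes_on X (U i) (s ! i)"
  shows "is_zero X (seq_product X s)"
proof -
  have "\<exists>a. a \<in> cocycles (fst (s ! i)) X \<and> snd (s ! i) = cohomology_class (fst (s ! i)) X a \<and>
      (\<forall>f. singular_simplex (fst (s ! i)) (subtopology X (U i)) f \<longrightarrow> a f = 0)" if i: "i < length s" for i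
  proof -
    let ?q = "fst (s ! i)"
    obtain z where z: "z \<in> cocycles ?q X" "snd (s ! i) = cohomology_class ?q X z"
        "cochain_restrict ?q X (U i) z \<in> coboundaries ?q (subtopology X (U i))"
      using van[OF i] by (auto simp: vanishes_on_def)
    \<comment> \<open>The coboundary d agrees with z on the simplices in \<open>U i\<close>, so z -
      d represents the same class and is zero there as a cochain.\<close>
    obtain d where d: "d \<in> coboundaries ?q X" "\<And>f. singular_simplex ?q (subtopology X (U i)) f \<Longrightarrow> z f = d f"
      using coboundary_extends[OF z(3)] by blast
    have "(\<lambda>f. z f - d f) \<in> cocycles ?q X"
      using z(1) d(1) coboundaries_subset_cocycles by (blast intro: cocycles_diff)
    moreover have "cohomology_class ?q X z = cohomology_class ?q X (\<lambda>f. z f - d f)"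
      by (rule cohomology_class_cong) (simp add: d(1))
    ultimately show ?thesis
      using z d by (intro exI[of _ "\<lambda>f. z f - d f"]) auto
  qed
  then obtain a where a: "\<And>i. i < length s \<Longrightarrow> a i \<in> cocycles (fst (s ! i)) X"
      "\<And>i. i < length s \<Longrightarrow> snd (s ! i) = cohomology_class (fst (s ! i)) X (a i)"
      "\<And>i f. i < length s \<Longrightarrow> singular_simplex (fst (s ! i)) (subtopology X (U i)) f \<Longrightarrow> a i f = 0"
    by metis
  define t where "t = map (\<lambda>i. (fst (s ! i), a i)) [0..<length s]"
  have t: "b \<in> cocycles q X" if "(q, b) \<in> set t" for q b
    using that a(1) by (auto simp: t_def)
  have s: "s = map (\<lambda>(q, a). (q, cohomology_class q X a)) t"
    by (rule nth_equalityI) (auto simp: t_def a(2)[symmetric])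
  have "seq_cup X t \<in> coboundaries (sum_list (map fst t)) X"
  proof (rule cocycle_vanishing_on_open_cover[of "U ` {..<length s}"])
    show "seq_cup X t f = 0" if V: "V \<in> U ` {..<length s}" and f: "singular_simplex (sum_list (map fst t)) (subtopology X V) f" for V f
    proof -
      obtain i where i: "i < length s" "V = U i"
        using V by auto
      then have "(fst (s ! i), a i) \<in> set t"
        by (auto simp: t_def)
      then show ?thesis
        by (rule seq_cup_vanishes[OF _ _ f]) (use a(3) i in auto)
    qed
  qed (use op cover cocycles_seq_cup[OF t] in auto)
  then show ?thesis
    by (subst s) (simp add: seq_product_class[OF t] is_zero_class_iff)
qed

section \<open>Finite complexes and their realization\<close>

text \<open>S need not be convex, it only has to contain the segments; P covers both free homotopies
  and those fixing the centre of a star-shaped set.\<close>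

lemma homotopic_with_line:
  fixes f g :: "'b \<Rightarrow> 'v \<Rightarrow> real"
  assumes f: "continuous_map Y (powertop_real UNIV) f" and g: "continuous_map Y (powertop_real UNIV) g"
    and S: "\<And>y t. y \<in> topspace Y \<Longrightarrow> 0 \<le> t \<Longrightarrow> t \<le> 1 \<Longrightarrow> (\<lambda>v. (1 - t) * f y v + t * g y v) \<in> S"
    and P: "\<And>t. 0 \<le> t \<Longrightarrow> t \<le> 1 \<Longrightarrow> P (\<lambda>y v. (1 - t) * f y v + t * g y v)"
  shows "homotopic_with P Y (subtopology (powertop_real UNIV) S) f g"
  unfolding homotopic_with_def
proof (intro exI conjI allI ballI)
  let ?h = "\<lambda>(t::real, y) v. (1 - t) * f y v + t * g y v"
  let ?Z = "prod_topology (top_of_set {0..1}) Y"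
  have fst: "continuous_map ?Z euclideanreal fst"
    using continuous_map_compose[OF continuous_map_fst[of "top_of_set {0..1}" Y], of euclideanreal id]
    by (simp add: continuous_map_from_subtopology)
  have comp: "continuous_map ?Z euclideanreal (\<lambda>z. k (snd z) v)"
    if "continuous_map Y (powertop_real UNIV) k" for k :: "'b \<Rightarrow> 'v \<Rightarrow> real" and v
    using continuous_map_compose[OF continuous_map_snd, of Y euclideanreal "\<lambda>y. k y v"] that
    by (simp add: continuous_map_componentwise_UNIV o_def)
  have "continuous_map ?Z (powertop_real UNIV) ?h"
    unfolding continuous_map_componentwise_UNIV case_prod_unfold
    by (intro allI continuous_map_add continuous_map_real_mult continuous_map_diff comp f g fst continuous_map_const[THEN iffD2])
      auto
  then show "continuous_map ?Z (subtopology (powertop_real UNIV) S) ?h"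
    using S by (auto simp: continuous_map_in_subtopology)
qed (use P in auto)

lemma continuous_map_coord:
  "continuous_map (subtopology (powertop_real UNIV) S) euclideanreal (\<lambda>x. x v)"
  by (auto intro: continuous_map_from_subtopology continuous_map_product_projection)

section \<open>Categorical sets and vanishing cohomology under homeomorphisms\<close>

lemma categorical_in_subset:
  assumes "categorical_in X B" "A \<subseteq> B"
  shows "categorical_in X A"
proof -
  obtain c where c: "B \<subseteq> topspace X" "c \<in> topspace X"
      "homotopic_with (\<lambda>_. True) (subtopology X B) X id (\<lambda>_. c)"
    using assms(1) by (auto simp: categorical_in_def)
  then have "homotopic_with (\<lambda>_. True) (subtopology X A) X id (\<lambda>_. c)"
    using homotopic_from_subtopology[OF c(3), of A] assms(2) by (simp add: subtopology_subtopology Int_absorb1)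
  then show ?thesis
    using c assms(2) by (auto simp: categorical_in_def)
qed

lemma categorical_in_homeomorphic_image:
  assumes hom: "homeomorphic_map Y X h" and B: "categorical_in Y B"
  shows "categorical_in X (h ` B)"
proof -
  obtain g where hg: "homeomorphic_maps Y X h g"
    using hom homeomorphic_map_maps by blast
  have conth: "continuous_map Y X h"
    using hom homeomorphic_imp_continuous_map by blast
  obtain c where c: "B \<subseteq> topspace Y" "c \<in> topspace Y"
      "homotopic_with (\<lambda>_. True) (subtopology Y B) Y id (\<lambda>_. c)"
    using B by (auto simp: categorical_in_def)
  have "homeomorphic_maps (subtopology Y B) (subtopology X (h ` B)) h g"
  proof (rule homeomorphic_maps_subtopologies[OF hg])
    have "h ` B \<subseteq> topspace X"
      using conth c(1) by (auto simp: continuous_map_def)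
    then show "h ` (topspace Y \<inter> B) = topspace X \<inter> h ` B"
      using c(1) by (simp add: Int_absorb1)
  qed
  then have "continuous_map (subtopology X (h ` B)) (subtopology Y B) g"
    by (simp add: homeomorphic_maps_def)
  then have "homotopic_with (\<lambda>_. True) (subtopology X (h ` B)) X (h \<circ> id \<circ> g) (h \<circ> (\<lambda>_. c) \<circ> g)"
    by (intro homotopic_with_compose_continuous_map_right[OF
          homotopic_with_compose_continuous_map_left[OF c(3) conth]]) auto
  then have "homotopic_with (\<lambda>_. True) (subtopology X (h ` B)) X id (\<lambda>_. h c)"
    by (rule homotopic_with_eq) (use hg c(1) in \<open>auto simp: homeomorphic_maps_def\<close>)
  moreover have "h ` B \<subseteq> topspace X" "h c \<in> topspace X"
    using conth c by (auto simp: continuous_map_def)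
  ultimately show ?thesis
    by (auto simp: categorical_in_def)
qed

lemma ls_cat_le:
  fixes X :: "'a topology"
  assumes "finite L" "A = (\<Union>l\<in>L. U l)"
    and "\<And>l. l \<in> L \<Longrightarrow> openin (subtopology X A) (U l)" "\<And>l. l \<in> L \<Longrightarrow> categorical_in X (U l)"
  shows "ls_cat X A \<le> enat (card L)"
proof -
  obtain e where e: "bij_betw e {0..<card L} L"
    using ex_bij_betw_nat_finite[OF assms(1)] by blast
  have eL: "e i \<in> L" if "i < card L" for i
    using e that by (auto simp: bij_betw_def)
  have "A = (\<Union>i<card L. U (e i))"
    using e assms(2) by (force simp: bij_betw_def)
  then have "enat (card L) \<in> {enat k | k. \<exists>U :: nat \<Rightarrow> 'a set. A = (\<Union>i<k. U i) \<and>
     (\<forall>i<k. openin (subtopology X A) (U i) \<and> categorical_in X (U i))}"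
    using assms(3,4) eL by (intro CollectI exI[of _ "card L"] exI[of _ "\<lambda>i. U (e i)"] conjI) auto
  then show ?thesis
    unfolding ls_cat_def by (rule Inf_lower)
qed

lemma simplex_map_singular_face:
  assumes "k \<le> Suc p"
  shows "singular_face (Suc p) k (simplex_map (Suc p) h f) = simplex_map p h (singular_face (Suc p) k f)"
proof -
  have "singular_face (Suc p) k (simplex_map (Suc p) h f) = simplex_map p h (f \<circ> simplical_face k)"
    using assms singular_face_simplex_map[of "Suc p" k h f] by simp
  also have "\<dots> = simplex_map p h (singular_face (Suc p) k f)"
    by (rule ext) (simp add: simplex_map_def singular_face_def)
  finally show ?thesis .
qed

text \<open>The acyclic sets live in the realization, the classes on X. Pulling a cocycle back along
  h and the primitive along g returns to the given cocycle because h (g x) = x.\<close>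

lemma cohomology_vanishes_homeomorphic:
  fixes X :: "'a topology" and Y :: "'b topology"
  assumes h: "homeomorphic_map Y X h"
    and van: "cocycles q Y \<subseteq> (coboundaries q Y :: ('b, 'r::comm_ring_1) cochain set)"
  shows "cocycles q X \<subseteq> (coboundaries q X :: ('a, 'r) cochain set)"
proof
  obtain g where "homeomorphic_maps Y X h g"
    using h homeomorphic_map_maps by blast
  then have conth: "continuous_map Y X h" and contg: "continuous_map X Y g" and hg: "\<And>x. x \<in> topspace X \<Longrightarrow> h (g x) = x"
    by (auto simp: homeomorphic_maps_def)
  fix c :: "('a, 'r) cochain"
  assume c: "c \<in> cocycles q X"
  define pull where "pull = (\<lambda>p (c :: ('a, 'r) cochain) f. if singular_simplex p Y f then c (simplex_map p h f) else 0)"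
  define push where "push = (\<lambda>p (e :: ('b, 'r) cochain) f. if singular_simplex p X f then e (simplex_map p g f) else 0)"
  have pull: "pull p c \<in> cochains p Y" and push: "push p e \<in> cochains p X" for p c e
    by (simp_all add: pull_def push_def cochains_def)
  have pull_d: "coboundary p Y (pull p c) = pull (Suc p) (coboundary p X c)" for p c
  proof
    fix f
    show "coboundary p Y (pull p c) f = pull (Suc p) (coboundary p X c) f"
      using singular_simplex_simplex_map[of "Suc p" Y f X h] conth singular_simplex_singular_face[of "Suc p" Y f]
      by (auto simp: coboundary_def pull_def simplex_map_singular_face simp del: sum.atMost_Suc intro!: sum.cong)
  qed
  have push_d: "coboundary p X (push p e) = push (Suc p) (coboundary p Y e)" for p e
  proof
    fix f
    show "coboundary p X (push p e) f = push (Suc p) (coboundary p Y e) f"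
      using singular_simplex_simplex_map[of "Suc p" X f Y g] contg singular_simplex_singular_face[of "Suc p" X f]
      by (auto simp: coboundary_def push_def simplex_map_singular_face simp del: sum.atMost_Suc intro!: sum.cong)
  qed
  have "push q (pull q c) f = c f" for f
  proof (cases "singular_simplex q X f")
    case True
    have "simplex_map q h (simplex_map q g f) = simplex_map q (h \<circ> g) f"
      by (simp add: simplex_map_compose)
    also have "\<dots> = f"
      using True hg by (simp add: simplex_map_id_gen)
    finally show ?thesis
      using True singular_simplex_simplex_map[OF True contg] by (simp add: push_def pull_def)
  qed (use c in \<open>auto simp: push_def cocycles_def cochains_def\<close>)
  then have push_pull: "push q (pull q c) = c"
    by (rule ext)
  have "pull q c \<in> cocycles q Y"
    using c pull by (simp add: cocycles_def pull_d) (simp add: pull_def)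
  then have "pull q c \<in> coboundaries q Y"
    using van by blast
  then show "c \<in> coboundaries q X"
  proof (cases q)
    case 0
    then have "pull q c = (\<lambda>f. 0)"
      using \<open>pull q c \<in> coboundaries q Y\<close> by simp
    then have "c = (\<lambda>f. 0)"
      using push_pull by (metis push_def)
    then show ?thesis
      by (simp only: coboundaries_zero)
  next
    case (Suc p)
    then obtain e where "pull q c = coboundary p Y e"
      using \<open>pull q c \<in> coboundaries q Y\<close> by auto
    then have "c = coboundary p X (push p e)"
      using push_pull by (simp add: push_d Suc)
    then show ?thesis
      using push by (auto simp: Suc)
  qed
qed

section \<open>Finite complexes as subspaces of a product of lines\<close>

locale finite_complex =
  fixes K :: "'v set set"
  assumes complex: "abstract_simplicial_complex K" and finite_vertices: "finite (\<Union>K)"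
begin

lemma face_closed: "\<sigma> \<in> K \<Longrightarrow> \<tau> \<subseteq> \<sigma> \<Longrightarrow> \<tau> \<noteq> {} \<Longrightarrow> \<tau> \<in> K"
  and simplex_finite: "\<sigma> \<in> K \<Longrightarrow> finite \<sigma>"
  and simplex_nonempty: "\<sigma> \<in> K \<Longrightarrow> \<sigma> \<noteq> {}"
  using complex unfolding abstract_simplicial_complex_def by blast+

lemma finite_complex: "finite K"
  using finite_vertices finite_UnionD by blast

text \<open>Membership is read off the support; summing over all vertices avoids naming a simplex
  that contains the point.\<close>

definition points :: "('v \<Rightarrow> real) set" where
  "points = {x. (\<forall>v. 0 \<le> x v) \<and> {v. x v \<noteq> 0} \<in> K \<and> (\<Sum>v\<in>\<Union>K. x v) = 1}"

lemma sum_vertices: "\<tau> \<subseteq> \<Union>K \<Longrightarrow> {v. x v \<noteq> 0} \<subseteq> \<tau> \<Longrightarrow> (\<Sum>v\<in>\<Union>K. x v) = (\<Sum>v\<in>\<tau>. x v)" for x :: "'v \<Rightarrow> real"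
  using finite_vertices by (intro sum.mono_neutral_right) auto

lemma supp_nonempty: "(\<Sum>v\<in>\<Union>K. x v) = 1 \<Longrightarrow> {v. x v \<noteq> 0} \<noteq> {}" for x :: "'v \<Rightarrow> real"
  using sum.neutral[of "\<Union>K" x] by force

lemma pointsI:
  assumes "\<tau> \<in> K" "\<And>v. 0 \<le> x v" "\<And>v. x v \<noteq> 0 \<Longrightarrow> v \<in> \<tau>" "(\<Sum>v\<in>\<Union>K. x v) = 1"
  shows "x \<in> points"
proof -
  have "{v. x v \<noteq> 0} \<in> K"
    using assms supp_nonempty[of x] by (intro face_closed[OF assms(1)]) blast+
  then show ?thesis
    using assms by (simp add: points_def)
qed

lemma Union_closed_simplex: "(\<Union>\<sigma>\<in>K. closed_simplex \<sigma>) = points"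
proof (intro Set.set_eqI iffI)
  fix x
  assume "x \<in> (\<Union>\<sigma>\<in>K. closed_simplex \<sigma>)"
  then obtain \<sigma> where "\<sigma> \<in> K" "x \<in> closed_simplex \<sigma>"
    by blast
  then show "x \<in> points"
    using sum_vertices[of \<sigma> x] by (intro pointsI[of \<sigma>]) (auto simp: closed_simplex_def)
next
  fix x
  assume x: "x \<in> points"
  then have "x \<in> closed_simplex {v. x v \<noteq> 0}"
    using sum_vertices[of "{v. x v \<noteq> 0}" x] by (auto simp: closed_simplex_def points_def)
  then show "x \<in> (\<Union>\<sigma>\<in>K. closed_simplex \<sigma>)"
    using x by (auto simp: points_def)
qed

text \<open>Closed simplices are closed in the product and finite in number, so the complement of a
  weakly open set is a finite union of closed sets. Continuity can then be checked
  coordinatewise.\<close>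

lemma geometric_realization_eq: "geometric_realization K = subtopology (powertop_real UNIV) points"
proof (rule topology_eq[THEN iffD2], rule allI)
  fix U
  let ?T = "subtopology (powertop_real UNIV) points"
  have sub: "closed_simplex \<sigma> \<subseteq> points" if "\<sigma> \<in> K" for \<sigma>
    using that Union_closed_simplex by blast
  have closed: "closedin (powertop_real UNIV) (closed_simplex \<sigma>)" if fin: "finite \<sigma>" for \<sigma> :: "'v set"
  proof -
    have eq: "closed_simplex \<sigma> =
        (\<Inter>v. {x \<in> topspace (powertop_real UNIV). x v \<in> (if v \<in> \<sigma> then {0..} else {0})}) \<inter>
        {x \<in> topspace (powertop_real UNIV). (\<Sum>v\<in>\<sigma>. x v) \<in> {1}}"
      by (auto simp: closed_simplex_def topspace_product_topology split: if_splits) (metis order.refl)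
    have "closedin (powertop_real UNIV) {x \<in> topspace (powertop_real UNIV). x v \<in> (if v \<in> \<sigma> then {0..} else {0})}"
      for v :: 'v
      by (rule closedin_continuous_map_preimage[of _ euclideanreal]) (auto intro: continuous_map_product_projection)
    moreover have "closedin (powertop_real UNIV) {x \<in> topspace (powertop_real UNIV). (\<Sum>v\<in>\<sigma>. x v) \<in> {1}}"
      using fin by (intro closedin_continuous_map_preimage[of _ euclideanreal] continuous_map_sum)
        (auto intro: continuous_map_product_projection)
    ultimately show ?thesis
      unfolding eq by (intro closedin_Int closedin_Inter) auto
  qed
  show "openin (geometric_realization K) U \<longleftrightarrow> openin ?T U"
  proof
    assume "openin ?T U"
    then obtain O' where O': "openin (powertop_real UNIV) O'" "U = O' \<inter> points"
      by (auto simp: openin_subtopology)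
    have "openin (subtopology (powertop_real UNIV) (closed_simplex \<sigma>)) (U \<inter> closed_simplex \<sigma>)" if "\<sigma> \<in> K" for \<sigma>
      using O' sub[OF that] by (auto simp: openin_subtopology)
    then show "openin (geometric_realization K) U"
      using O' by (auto simp: openin_geometric_realization Union_closed_simplex)
  next
    assume U: "openin (geometric_realization K) U"
    then have "U \<subseteq> points"
      by (simp add: openin_geometric_realization Union_closed_simplex)
    have "closedin (powertop_real UNIV) (closed_simplex \<sigma> - U)" if "\<sigma> \<in> K" for \<sigma>
    proof -
      let ?S = "subtopology (powertop_real UNIV) (closed_simplex \<sigma>)"
      have "openin ?S (U \<inter> closed_simplex \<sigma>)"
        using U that by (simp add: openin_geometric_realization)
      then have "closedin ?S (topspace ?S - (U \<inter> closed_simplex \<sigma>))"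
        by (rule closedin_diff[OF closedin_topspace])
      moreover have "topspace ?S - (U \<inter> closed_simplex \<sigma>) = closed_simplex \<sigma> - U"
        by auto
      ultimately show ?thesis
        using closedin_trans_full[OF _ closed[OF simplex_finite[OF that]]] by simp
    qed
    then have "closedin (powertop_real UNIV) (\<Union>\<sigma>\<in>K. closed_simplex \<sigma> - U)"
      using finite_complex by (intro closedin_Union) auto
    moreover have "U = (topspace (powertop_real UNIV) - (\<Union>\<sigma>\<in>K. closed_simplex \<sigma> - U)) \<inter> points"
      using \<open>U \<subseteq> points\<close> by (auto simp flip: Union_closed_simplex)
    ultimately show "openin ?T U"
      unfolding openin_subtopology by blast
  qed
qed

lemma topspace_realization [simp]: "topspace (geometric_realization K) = points"
  by (simp add: topspace_geometric_realization Union_closed_simplex)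

lemma subtopology_realization:
  "A \<subseteq> points \<Longrightarrow> subtopology (geometric_realization K) A = subtopology (powertop_real UNIV) A"
  by (simp add: geometric_realization_eq subtopology_subtopology Int_absorb1)

lemma continuous_map_realization_coord: "continuous_map (geometric_realization K) euclideanreal (\<lambda>x. x v)"
  by (simp add: geometric_realization_eq continuous_map_coord)

lemma line_in_points:
  assumes "\<tau> \<in> K" and x: "\<And>v. 0 \<le> x v" "\<And>v. x v \<noteq> 0 \<Longrightarrow> v \<in> \<tau>" "(\<Sum>v\<in>\<Union>K. x v) = 1"
    and y: "\<And>v. 0 \<le> y v" "\<And>v. y v \<noteq> 0 \<Longrightarrow> v \<in> \<tau>" "(\<Sum>v\<in>\<Union>K. y v) = 1"
    and t: "0 \<le> t" "t \<le> 1"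
  shows "(\<lambda>v. (1 - t) * x v + t * y v) \<in> points"
proof (rule pointsI[OF assms(1)])
  show "(\<Sum>v\<in>\<Union>K. (1 - t) * x v + t * y v) = 1"
    by (simp add: sum.distrib x(3) y(3) flip: sum_distrib_left)
  show "v \<in> \<tau>" if "(1 - t) * x v + t * y v \<noteq> 0" for v
    using that x(2)[of v] y(2)[of v] by (cases "x v = 0") auto
  show "0 \<le> (1 - t) * x v + t * y v" for v
    using x(1)[of v] y(1)[of v] t by simp
qed

end

section \<open>An acyclic cover by levels\<close>

context finite_complex
begin

lemma normalize:
  fixes x :: "'v \<Rightarrow> real"
  assumes "S \<subseteq> \<Union>K" "0 < (\<Sum>v\<in>S. x v)" "\<And>v. 0 \<le> x v"
  defines "y \<equiv> \<lambda>v. if v \<in> S then x v / (\<Sum>v\<in>S. x v) else 0"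
  shows "(\<Sum>v\<in>\<Union>K. y v) = 1" "\<And>v. 0 \<le> y v"
proof -
  have "(\<Sum>v\<in>\<Union>K. y v) = (\<Sum>v\<in>S. x v / (\<Sum>v\<in>S. x v))"
    unfolding y_def using assms(1) finite_vertices by (intro sum.mono_neutral_cong_right) auto
  then show "(\<Sum>v\<in>\<Union>K. y v) = 1"
    using assms(2) by (simp flip: sum_divide_distrib)
  show "0 \<le> y v" for v
    using assms(2,3) by (simp add: y_def)
qed

text \<open>The open star of a simplex is pushed into the closed simplex and then to a vertex.\<close>

lemma categorical_in_star:
  assumes \<sigma>: "\<sigma> \<in> K"
  shows "categorical_in (geometric_realization K) {x \<in> points. 0 < (\<Sum>v\<in>\<sigma>. x v)}"
proof -
  let ?T = "geometric_realization K" and ?O = "{x \<in> points. 0 < (\<Sum>v\<in>\<sigma>. x v)}"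
  let ?S = "subtopology (powertop_real UNIV) ?O"
  define r where "r = (\<lambda>(x :: 'v \<Rightarrow> real) v. if v \<in> \<sigma> then x v / (\<Sum>v\<in>\<sigma>. x v) else 0)"
  obtain a where a: "a \<in> \<sigma>"
    using simplex_nonempty[OF \<sigma>] by blast
  define e where "e = (\<lambda>v. if v = a then 1 else 0 :: real)"
  have sub: "\<sigma> \<subseteq> \<Union>K"
    using \<sigma> by blast
  have e: "0 \<le> e v" "e v \<noteq> 0 \<Longrightarrow> v \<in> \<sigma>" for v
    using a by (auto simp: e_def split: if_splits)
  have sum_e: "(\<Sum>v\<in>\<Union>K. e v) = 1"
    using finite_vertices a sub by (auto simp: e_def)
  have T: "subtopology ?T ?O = ?S"
    by (rule subtopology_realization) auto
  have "continuous_map ?S euclideanreal (\<lambda>x. r x v)" for v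
  proof (cases "v \<in> \<sigma>")
    case True
    have "continuous_map ?S euclideanreal (\<lambda>x. x v / (\<Sum>v\<in>\<sigma>. x v))"
      using simplex_finite[OF \<sigma>]
      by (intro continuous_map_real_divide continuous_map_sum continuous_map_coord) auto
    then show ?thesis
      using True by (simp add: r_def)
  qed (simp add: r_def)
  then have contr: "continuous_map ?S (powertop_real UNIV) r"
    by (simp add: continuous_map_componentwise_UNIV)
  have r: "(\<Sum>v\<in>\<Union>K. r x v) = 1" "0 \<le> r x v" if "x \<in> ?O" for x v
    using normalize[OF sub, of x] that by (auto simp: r_def points_def)
  have r0: "r x v \<noteq> 0 \<Longrightarrow> v \<in> \<sigma> \<and> x v \<noteq> 0" for x v
    by (auto simp: r_def split: if_splits)
  have "homotopic_with (\<lambda>_. True) ?S ?T id r"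
    unfolding geometric_realization_eq
  proof (rule homotopic_with_line[OF _ contr])
    fix x and t :: real
    assume "x \<in> topspace ?S" and t: "0 \<le> t" "t \<le> 1"
    then have x: "x \<in> ?O"
      by simp
    \<comment> \<open>As \<open>r x\<close> is zero wherever x is, this segment stays in the simplex
      spanned by the support of x; the later segment from \<open>r x\<close> to e stays in
      \<open>\<sigma>\<close>.\<close>
    then show "(\<lambda>v. (1 - t) * id x v + t * r x v) \<in> points"
      using r[OF x] r0[of x] t by (intro line_in_points[of "{v. x v \<noteq> 0}"]) (auto simp: points_def)
  qed (auto intro: continuous_map_from_subtopology)
  moreover have "homotopic_with (\<lambda>_. True) ?S ?T r (\<lambda>_. e)"
    unfolding geometric_realization_eq
  proof (rule homotopic_with_line[OF contr])
    fix x and t :: real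
    assume "x \<in> topspace ?S" and t: "0 \<le> t" "t \<le> 1"
    then have x: "x \<in> ?O"
      by simp
    then show "(\<lambda>v. (1 - t) * r x v + t * e v) \<in> points"
      using r[OF x] r0[of x] t e sum_e by (intro line_in_points[OF \<sigma>]) blast+
  qed auto
  ultimately have "homotopic_with (\<lambda>_. True) ?S ?T id (\<lambda>_. e)"
    by (rule homotopic_with_trans)
  moreover have "e \<in> points"
    using e sum_e by (intro pointsI[OF \<sigma>]) blast+
  ultimately show ?thesis
    unfolding categorical_in_def T by auto
qed


text \<open>For A = \<open>\<Union>K\<close> this is the open star of the barycentre of
  \<open>\<sigma>\<close> in the barycentric subdivision; for smaller A, vertices outside A are
  ignored.\<close>

definition top_star :: "'v set \<Rightarrow> 'v set \<Rightarrow> ('v \<Rightarrow> real) set" where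
  "top_star A \<sigma> = {x \<in> points. (\<forall>v\<in>\<sigma>. 0 < x v) \<and> (\<forall>v\<in>\<sigma>. \<forall>w\<in>A - \<sigma>. x w < x v)}"

lemma openin_top_star:
  assumes "finite A" "\<sigma> \<subseteq> A"
  shows "openin (geometric_realization K) (top_star A \<sigma>)"
proof -
  let ?T = "geometric_realization K"
  have pos: "openin ?T {x \<in> topspace ?T. x v \<in> {0<..}}" for v
    by (rule openin_continuous_map_preimage[OF continuous_map_realization_coord]) simp
  have less: "openin ?T {x \<in> topspace ?T. x v - x w \<in> {0<..}}" for v w
    by (rule openin_continuous_map_preimage[OF continuous_map_diff[OF continuous_map_realization_coord continuous_map_realization_coord]]) simp
  have "openin ?T ((\<Inter>v\<in>\<sigma>. ((\<Inter>w\<in>A - \<sigma>. {x \<in> topspace ?T. x v - x w \<in> {0<..}}) \<inter> topspace ?T)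
      \<inter> {x \<in> topspace ?T. x v \<in> {0<..}}) \<inter> topspace ?T)"
    using assms finite_subset by (intro openin_INT openin_Int less pos) auto
  moreover have "top_star A \<sigma> = (\<Inter>v\<in>\<sigma>. ((\<Inter>w\<in>A - \<sigma>. {x \<in> topspace ?T. x v - x w \<in> {0<..}}) \<inter> topspace ?T)
      \<inter> {x \<in> topspace ?T. x v \<in> {0<..}}) \<inter> topspace ?T"
    by (auto simp: top_star_def)
  ultimately show ?thesis
    by simp
qed

text \<open>By equal cardinality each simplex has a vertex outside the other, and the two stars
  order the coordinates at these vertices oppositely.\<close>

lemma disjnt_top_star:
  assumes "\<sigma> \<subseteq> A" "\<tau> \<subseteq> A" "finite A" "card \<sigma> = card \<tau>" "\<sigma> \<noteq> \<tau>"
  shows "disjnt (top_star A \<sigma>) (top_star A \<tau>)"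
proof -
  have fin: "finite \<sigma>" "finite \<tau>"
    using assms finite_subset by blast+
  have "\<not> \<sigma> \<subseteq> \<tau>" "\<not> \<tau> \<subseteq> \<sigma>"
    using card_subset_eq[OF fin(2), of \<sigma>] card_subset_eq[OF fin(1), of \<tau>] assms(4,5) by auto
  then obtain v w where vw: "v \<in> \<sigma>" "v \<notin> \<tau>" "w \<in> \<tau>" "w \<notin> \<sigma>"
    by blast
  have False if "x \<in> top_star A \<sigma>" "x \<in> top_star A \<tau>" for x
  proof -
    have "x w < x v" "x v < x w"
      using that vw assms(1,2) by (auto simp: top_star_def)
    then show False
      by simp
  qed
  then show ?thesis
    by (auto simp: disjnt_def)
qed

text \<open>The intersection of the sets belonging to several simplices is star-shaped about the
  normalized restriction of any of its points to the union of these simplices.\<close>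

lemma cohomology_vanishes_top_stars:
  assumes C: "C \<noteq> {}" and \<phi>: "\<And>c. c \<in> C \<Longrightarrow> \<phi> c \<in> K \<and> \<phi> c \<subseteq> A"
  defines "P \<equiv> (\<Inter>c\<in>C. top_star A (\<phi> c))"
  shows "cocycles (Suc p) (subtopology (geometric_realization K) P) \<subseteq>
    (coboundaries (Suc p) (subtopology (geometric_realization K) P) :: ('v \<Rightarrow> real, 'r::comm_ring_1) cochain set)"
proof (cases "P = {}")
  case True
  then show ?thesis
    by (intro cocycles_empty) simp
next
  case False
  then obtain y where y: "y \<in> P"
    by blast
  define S where "S = (\<Union>c\<in>C. \<phi> c)"
  have P: "P \<subseteq> points"
    using C by (auto simp: P_def top_star_def)
  then have "y \<in> points"
    using y by blast
  have S_supp: "0 < x v" if "x \<in> P" "v \<in> S" for x v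
    using that by (auto simp: P_def S_def top_star_def)
  have SK: "S \<subseteq> \<Union>K"
    using \<phi> by (auto simp: S_def)
  have "S \<noteq> {}"
    using C \<phi> simplex_nonempty unfolding S_def by blast
  then have N: "0 < (\<Sum>v\<in>S. y v)"
    using SK finite_vertices y by (intro sum_pos S_supp) (auto intro: finite_subset)
  define b where "b = (\<lambda>v. if v \<in> S then y v / (\<Sum>v\<in>S. y v) else 0)"
  have b: "(\<Sum>v\<in>\<Union>K. b v) = 1" "\<And>v. 0 \<le> b v"
    using normalize[OF SK N] \<open>y \<in> points\<close> by (auto simp: b_def points_def)
  have b_pos: "0 < b v \<longleftrightarrow> v \<in> S" for v
    using N S_supp[OF y] by (simp add: b_def)
  \<comment> \<open>If w lies outside S, then \<open>b w\<close> is 0 and \<open>b v\<close> is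
    positive; otherwise b is a multiple of y at both vertices.\<close>
  have b_less: "b w < b v" if "c \<in> C" "v \<in> \<phi> c" "w \<in> A - \<phi> c" for c v w
  proof -
    have "y w < y v"
      using that y by (auto simp: P_def top_star_def)
    moreover have "v \<in> S"
      using that by (auto simp: S_def)
    ultimately show ?thesis
      using N S_supp[OF y, of v] by (simp add: b_def divide_strict_right_mono)
  qed
  have convex: "0 < (1 - t) * r + t * s" if "0 < r" "0 < s" "0 \<le> t" "t \<le> 1" for r s t :: real
    using that by (cases "t = 0") (auto intro: add_nonneg_pos)
  have line: "(\<lambda>v. (1 - t) * x v + t * b v) \<in> P" if x: "x \<in> P" and t: "0 \<le> t" "t \<le> 1" for x t
  proof -
    have xp: "x \<in> points"
      using x P by blast
    have pts: "(\<lambda>v. (1 - t) * x v + t * b v) \<in> points"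
    \<comment> \<open>All points of P are positive on S, the support of b, so the segment stays in
      the simplex spanned by the support of x.\<close>
    proof (rule line_in_points[of "{v. x v \<noteq> 0}"])
      show "v \<in> {v. x v \<noteq> 0}" if "b v \<noteq> 0" for v
        using that b(2)[of v] b_pos[of v] S_supp[OF x, of v] by force
    qed (use xp b t in \<open>auto simp: points_def\<close>)
    have "(\<lambda>v. (1 - t) * x v + t * b v) \<in> top_star A (\<phi> c)" if c: "c \<in> C" for c
    proof -
      have "0 < (1 - t) * x v + t * b v" if "v \<in> \<phi> c" for v
        using that c S_supp[OF x, of v] b_pos[of v] t by (intro convex) (auto simp: S_def)
      moreover have "(1 - t) * x w + t * b w < (1 - t) * x v + t * b v" if "v \<in> \<phi> c" "w \<in> A - \<phi> c" for v w
      proof -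
        have "x w < x v"
          using x c that by (auto simp: P_def top_star_def)
        then show ?thesis
          using convex[of "x v - x w" "b v - b w" t] b_less[OF c that] t by (simp add: algebra_simps)
      qed
      ultimately show ?thesis
        using pts by (simp add: top_star_def)
    qed
    then show ?thesis
      by (simp add: P_def)
  qed
  have bP: "b \<in> P"
    using line[OF y, of 1] by simp
  let ?S = "subtopology (powertop_real UNIV) P"
  have "homotopic_with (\<lambda>h. h b = b) ?S ?S id (\<lambda>_. b)"
  proof (rule homotopic_with_line)
    show "(\<lambda>v. (1 - t) * id b v + t * b v) = b" for t
      by (simp add: algebra_simps)
  qed (use line in \<open>auto intro: continuous_map_from_subtopology\<close>)
  then show ?thesis
    unfolding subtopology_realization[OF P] using bP by (intro cohomology_vanishes_contractible) auto
qed

text \<open>The index is the dimension, so the levels c < d suffice when simplices in A have at most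
  d vertices.\<close>

definition level :: "'v set \<Rightarrow> nat \<Rightarrow> ('v \<Rightarrow> real) set" where
  "level A c = (\<Union>\<sigma>\<in>{\<sigma> \<in> K. \<sigma> \<subseteq> A \<and> card \<sigma> = Suc c}. top_star A \<sigma>)"

lemma openin_level: "finite A \<Longrightarrow> openin (geometric_realization K) (level A c)"
  unfolding level_def by (intro openin_Union) (auto intro: openin_top_star)

text \<open>Distributing the intersection over the unions gives one piece for each choice of a
  simplex per level. Two choices differ at some level, where the simplices have equal cardinality,
  so the pieces are disjoint.\<close>

lemma cohomology_vanishes_levels:
  assumes D: "finite D" "D \<noteq> {}" and A: "finite A"
  shows "cocycles (Suc p) (subtopology (geometric_realization K) (\<Inter>c\<in>D. level A c)) \<subseteq>
    (coboundaries (Suc p) (subtopology (geometric_realization K) (\<Inter>c\<in>D. level A c)) :: ('v \<Rightarrow> real, 'r::comm_ring_1) cochain set)"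
proof -
  define \<Phi> where "\<Phi> = Pi\<^sub>E D (\<lambda>c. {\<sigma> \<in> K. \<sigma> \<subseteq> A \<and> card \<sigma> = Suc c})"
  have eq: "(\<Inter>c\<in>D. level A c) = (\<Union>\<phi>\<in>\<Phi>. \<Inter>c\<in>D. top_star A (\<phi> c))"
  proof (intro equalityI subsetI)
    fix x
    assume "x \<in> (\<Inter>c\<in>D. level A c)"
    then have "\<forall>c\<in>D. \<exists>\<sigma>. \<sigma> \<in> K \<and> \<sigma> \<subseteq> A \<and> card \<sigma> = Suc c \<and> x \<in> top_star A \<sigma>"
      by (auto simp: level_def)
    then obtain \<phi> where \<phi>: "\<And>c. c \<in> D \<Longrightarrow> \<phi> c \<in> K \<and> \<phi> c \<subseteq> A \<and> card (\<phi> c) = Suc c \<and> x \<in> top_star A (\<phi> c)"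
      by metis
    then have "restrict \<phi> D \<in> \<Phi>"
      by (auto simp: \<Phi>_def)
    then show "x \<in> (\<Union>\<phi>\<in>\<Phi>. \<Inter>c\<in>D. top_star A (\<phi> c))"
      using \<phi> by (intro UN_I[of "restrict \<phi> D"]) auto
  next
    fix x
    assume "x \<in> (\<Union>\<phi>\<in>\<Phi>. \<Inter>c\<in>D. top_star A (\<phi> c))"
    then obtain \<phi> where "\<phi> \<in> \<Phi>" "\<And>c. c \<in> D \<Longrightarrow> x \<in> top_star A (\<phi> c)"
      by blast
    then show "x \<in> (\<Inter>c\<in>D. level A c)"
      by (auto simp: level_def \<Phi>_def PiE_iff)
  qed
  show ?thesis
    unfolding eq
  proof (rule cohomology_vanishes_disjoint_union)
    show "openin (geometric_realization K) (\<Inter>c\<in>D. top_star A (\<phi> c))" if "\<phi> \<in> \<Phi>" for \<phi>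
      using that D A by (intro openin_INT2 openin_top_star) (auto simp: \<Phi>_def PiE_iff)
    show "pairwise (\<lambda>\<phi> \<psi>. disjnt (\<Inter>c\<in>D. top_star A (\<phi> c)) (\<Inter>c\<in>D. top_star A (\<psi> c))) \<Phi>"
    proof (rule pairwiseI)
      fix \<phi> \<psi>
      assume \<phi>\<psi>: "\<phi> \<in> \<Phi>" "\<psi> \<in> \<Phi>" "\<phi> \<noteq> \<psi>"
      then obtain c where c: "c \<in> D" "\<phi> c \<noteq> \<psi> c"
        unfolding \<Phi>_def by (meson PiE_ext)
      then have "disjnt (top_star A (\<phi> c)) (top_star A (\<psi> c))"
        using \<phi>\<psi>(1,2) A by (intro disjnt_top_star) (auto simp: \<Phi>_def PiE_iff)
      then show "disjnt (\<Inter>c\<in>D. top_star A (\<phi> c)) (\<Inter>c\<in>D. top_star A (\<psi> c))"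
        using c by (auto simp: disjnt_def)
    qed
    show "cocycles (Suc p) (subtopology (geometric_realization K) (\<Inter>c\<in>D. top_star A (\<phi> c))) \<subseteq>
        (coboundaries (Suc p) (subtopology (geometric_realization K) (\<Inter>c\<in>D. top_star A (\<phi> c))) :: ('v \<Rightarrow> real, 'r) cochain set)"
      if "\<phi> \<in> \<Phi>" for \<phi>
      using that D by (intro cohomology_vanishes_top_stars) (auto simp: \<Phi>_def PiE_iff)
  qed
qed

lemma cohomology_vanishes_Union_levels:
  assumes "finite D" "finite A" "card D \<le> q"
  shows "cocycles q (subtopology (geometric_realization K) (\<Union>c\<in>D. level A c)) \<subseteq>
    (coboundaries q (subtopology (geometric_realization K) (\<Union>c\<in>D. level A c)) :: ('v \<Rightarrow> real, 'r::comm_ring_1) cochain set)"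
proof (rule cohomology_vanishes_good_cover[OF assms(1)])
  show "cocycles (Suc p) (subtopology (geometric_realization K) (\<Inter>c\<in>E. level A c)) \<subseteq>
    (coboundaries (Suc p) (subtopology (geometric_realization K) (\<Inter>c\<in>E. level A c)) :: ('v \<Rightarrow> real, 'r) cochain set)"
    if "E \<subseteq> D" "E \<noteq> {}" for E p
    using that assms finite_subset by (intro cohomology_vanishes_levels) auto
qed (use assms openin_level in auto)

lemma in_level:
  assumes x: "x \<in> points" and A: "finite A" and v: "v \<in> A" "0 < x v"
    and small: "\<And>\<sigma>. \<sigma> \<in> K \<Longrightarrow> \<sigma> \<subseteq> A \<Longrightarrow> card \<sigma> \<le> d"
  shows "\<exists>c<d. x \<in> level A c"
proof -
  \<comment> \<open>The vertices of A at which x attains its maximum over A; positivity of that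
    maximum puts them into the support of x, so they span a simplex.\<close>
  define \<sigma> where "\<sigma> = {v \<in> A. x v = Max (x ` A)}"
  have le: "x w \<le> Max (x ` A)" if "w \<in> A" for w
    using A that by simp
  have "Max (x ` A) \<in> x ` A"
    using A v by (intro Max_in) auto
  then have ne: "\<sigma> \<noteq> {}"
    by (auto simp: \<sigma>_def)
  have pos: "0 < Max (x ` A)"
    using le[OF v(1)] v(2) by simp
  have "\<sigma> \<subseteq> {v. x v \<noteq> 0}"
    using pos by (auto simp: \<sigma>_def)
  then have \<sigma>: "\<sigma> \<in> K" "\<sigma> \<subseteq> A"
    using x ne face_closed by (auto simp: points_def \<sigma>_def)
  have "x \<in> top_star A \<sigma>"
    using x pos le by (auto simp: top_star_def \<sigma>_def order.strict_iff_order)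
  moreover have "0 < card \<sigma>"
    using ne \<sigma> simplex_finite by (auto simp: card_gt_0_iff)
  then obtain c where "card \<sigma> = Suc c"
    using gr0_conv_Suc by blast
  ultimately show ?thesis
    using \<sigma> small[OF \<sigma>] by (intro exI[of _ c]) (auto simp: level_def)
qed


end

section \<open>Counting vertices\<close>

text \<open>Each set \<open>U v\<close> omits all vertices of the realization except possibly v, so
  a finite subcover leaves only finitely many vertices.\<close>

lemma finite_vertices_if_compact:
  fixes K :: "'v set set"
  assumes K: "abstract_simplicial_complex K" and comp: "compact_space (geometric_realization K)"
  shows "finite (\<Union>K)"
proof -
  let ?T = "geometric_realization K"
  define e where "e = (\<lambda>(w :: 'v) v. if v = w then 1 else 0 :: real)"
  define U where "U = (\<lambda>v. {x \<in> topspace ?T. \<forall>w\<in>\<Union>K. w \<noteq> v \<longrightarrow> x \<noteq> e w})"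
  have fin: "finite \<sigma>" if "\<sigma> \<in> K" for \<sigma>
    using that K by (auto simp: abstract_simplicial_complex_def)
  have e_in: "e w \<in> closed_simplex \<sigma> \<longleftrightarrow> w \<in> \<sigma>" if "\<sigma> \<in> K" for w \<sigma>
    using fin[OF that] by (auto simp: closed_simplex_def e_def)
  have e_inj: "e v = e w \<longleftrightarrow> v = w" for v w
    by (metis e_def zero_neq_one)
  \<comment> \<open>A closed simplex contains finitely many vertices, and finite sets are closed; in
    the weak topology this is enough.\<close>
  have open_U: "openin ?T (U v)" for v
    unfolding openin_geometric_realization
  proof (intro conjI ballI)
    show "U v \<subseteq> (\<Union>\<sigma>\<in>K. closed_simplex \<sigma>)"
      by (auto simp: U_def topspace_geometric_realization)
    fix \<sigma>
    assume \<sigma>: "\<sigma> \<in> K"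
    have "closedin (powertop_real UNIV) (e ` (\<sigma> - {v}))"
      using fin[OF \<sigma>] by (intro closedin_Hausdorff_finite) (auto simp: Hausdorff_space_product_topology)
    moreover have "U v \<inter> closed_simplex \<sigma> = (topspace (powertop_real UNIV) - e ` (\<sigma> - {v})) \<inter> closed_simplex \<sigma>"
      using \<sigma> e_in[OF \<sigma>] by (auto simp: U_def topspace_geometric_realization)
    ultimately show "openin (subtopology (powertop_real UNIV) (closed_simplex \<sigma>)) (U v \<inter> closed_simplex \<sigma>)"
      unfolding openin_subtopology by blast
  qed
  have vertex: "e w \<in> topspace ?T" if "w \<in> \<Union>K" for w
    using that e_in by (auto simp: topspace_geometric_realization)
  show ?thesis
  proof (cases "\<Union>K = {}")
    case False
    have "x \<in> \<Union>(U ` \<Union>K)" if x: "x \<in> topspace ?T" for x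
    proof (cases "\<exists>w\<in>\<Union>K. x = e w")
      case True
      then obtain w where "w \<in> \<Union>K" "x = e w"
        by blast
      then have "x \<in> U w"
        using x by (simp add: U_def e_inj)
      then show ?thesis
        using \<open>w \<in> \<Union>K\<close> by blast
    next
      case no_vertex: False
      obtain v where "v \<in> \<Union>K"
        using False by blast
      moreover have "x \<in> U v"
        using x no_vertex unfolding U_def by blast
      ultimately show ?thesis
        by blast
    qed
    then have "topspace ?T \<subseteq> \<Union>(U ` \<Union>K)"
      by (rule subsetI)
    then obtain \<F> where "finite \<F>" "\<F> \<subseteq> U ` \<Union>K" "topspace ?T \<subseteq> \<Union>\<F>"
      using compactinD[OF comp[unfolded compact_space_def], of "U ` \<Union>K"] open_U by blast
    then obtain V where V: "finite V" "topspace ?T \<subseteq> \<Union>(U ` V)"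
      by (metis finite_subset_image)
    have "w \<in> V" if w: "w \<in> \<Union>K" for w
    proof -
      obtain v where "v \<in> V" "e w \<in> U v"
        using V(2) vertex[OF w] by blast
      then have "w = v"
        using w unfolding U_def by blast
      then show ?thesis
        using \<open>v \<in> V\<close> by simp
    qed
    then have "\<Union>K \<subseteq> V"
      by (rule subsetI)
    then show ?thesis
      using V(1) by (rule finite_subset)
  next
    case True
    then show ?thesis
      by (metis finite.emptyI)
  qed
qed

section \<open>Allocations, subsequences and category weight\<close>

lemma categorical_in_empty:
  assumes "topspace X \<noteq> {}"
  shows "categorical_in X {}"
proof -
  obtain c where "c \<in> topspace X"
    using assms by blast
  moreover have "homotopic_with (\<lambda>_. True) (subtopology X {}) X id (\<lambda>_. c)"
    by (simp add: homotopic_on_emptyI)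
  ultimately show ?thesis
    unfolding categorical_in_def by blast
qed

lemma sum_UN_le:
  fixes f :: "'b \<Rightarrow> real"
  assumes "finite I" "\<And>i. i \<in> I \<Longrightarrow> finite (B i)" "\<And>v. 0 \<le> f v"
  shows "sum f (\<Union>i\<in>I. B i) \<le> (\<Sum>i\<in>I. sum f (B i))"
  using assms(1,2)
proof (induction I rule: finite_induct)
  case (insert i I)
  have "sum f (B i \<union> (\<Union>i\<in>I. B i)) + sum f (B i \<inter> (\<Union>i\<in>I. B i)) = sum f (B i) + sum f (\<Union>i\<in>I. B i)"
    using insert by (intro sum.union_inter) auto
  moreover have "0 \<le> sum f (B i \<inter> (\<Union>i\<in>I. B i))"
    by (intro sum_nonneg assms)
  ultimately show ?case
    using insert by simp
qed simp

text \<open>Inject the n items into the disjoint union of sets of sizes \<open>k i\<close>. This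
  distributes levels by degree and removed simplices by weight.\<close>

lemma ex_allocation:
  fixes k :: "'i \<Rightarrow> nat"
  assumes "finite S" "n \<le> (\<Sum>i\<in>S. k i)"
  shows "\<exists>f. (\<forall>l<n. f l \<in> S) \<and> (\<forall>i\<in>S. card {l. l < n \<and> f l = i} \<le> k i)"
proof -
  have "card {..<n} \<le> card (SIGMA i:S. {..<k i})"
    using assms by simp
  then obtain h where h: "h ` {..<n} \<subseteq> (SIGMA i:S. {..<k i})" "inj_on h {..<n}"
    using card_le_inj[of "{..<n}" "SIGMA i:S. {..<k i}"] assms(1) by auto
  show ?thesis
  proof (intro exI[of _ "fst \<circ> h"] conjI allI ballI impI)
    show "(fst \<circ> h) l \<in> S" if "l < n" for l
      using h(1) that by (force simp: image_subset_iff)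
    show "card {l. l < n \<and> (fst \<circ> h) l = i} \<le> k i" if "i \<in> S" for i
    proof -
      let ?L = "{l. l < n \<and> (fst \<circ> h) l = i}"
      have "inj_on (snd \<circ> h) ?L"
        using h(2) by (auto simp: inj_on_def prod_eq_iff)
      moreover have "(snd \<circ> h) ` ?L \<subseteq> {..<k i}"
        using h(1) by (force simp: image_subset_iff)
      ultimately have "card ?L \<le> card {..<k i}"
        by (rule card_inj_on_le) simp
      then show ?thesis
        by simp
    qed
  qed
qed

text \<open>Indices give a subsequence a complement even if entries repeat; one set I serves all f,
  thus degree and weight at once.\<close>

lemma submset_index_set:
  assumes "mset s' \<subseteq># mset s"
  shows "\<exists>I\<subseteq>{..<length s}. \<forall>f :: 'b \<Rightarrow> nat. (\<Sum>i\<in>I. f (s ! i)) = sum_list (map f s')"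
  using assms
proof (induction s arbitrary: s')
  case (Cons a s)
  have shift: "(\<Sum>i\<in>Suc ` I. f ((a # s) ! i)) = (\<Sum>i\<in>I. f (s ! i))" for f :: "'b \<Rightarrow> nat" and I
    by (simp add: sum.reindex)
  show ?case
  proof (cases "a \<in> set s'")
    case True
    \<comment> \<open>One occurrence of a is matched with index 0; further ones are left to the
      tail.\<close>
    then have "mset (remove1 a s') \<subseteq># mset s"
      using Cons.prems by (simp add: subset_eq_diff_conv)
    then obtain I where I: "I \<subseteq> {..<length s}"
        "\<And>f :: 'b \<Rightarrow> nat. (\<Sum>i\<in>I. f (s ! i)) = sum_list (map f (remove1 a s'))"
      using Cons.IH by metis
    have "finite I"
      using I(1) finite_subset by blast
    then have "(\<Sum>i\<in>insert 0 (Suc ` I). f ((a # s) ! i)) = sum_list (map f s')" for f :: "'b \<Rightarrow> nat"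
      using sum_list_map_remove1[OF True, of f] I(2)[of f] shift[of f I] by simp
    then show ?thesis
      using I(1) by (intro exI[of _ "insert 0 (Suc ` I)"]) auto
  next
    case False
    have "mset s' \<subseteq># mset s"
    proof (rule mset_subset_eqI)
      show "count (mset s') x \<le> count (mset s) x" for x
        using mset_subset_eq_count[OF Cons.prems, of x] False by (cases "x = a") (simp_all add: count_eq_zero_iff[THEN iffD2])
    qed
    then obtain I where I: "I \<subseteq> {..<length s}"
        "\<And>f :: 'b \<Rightarrow> nat. (\<Sum>i\<in>I. f (s ! i)) = sum_list (map f s')"
      using Cons.IH by metis
    then show ?thesis
      using shift by (intro exI[of _ "Suc ` I"]) auto
  qed
qed simp

lemma fst_seq_product: "fst (seq_product X s) = sum_list (map fst s)"
  by (induction s) auto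

text \<open>If no admissible m reached k, all would be at most k - 1 and so would their supremum. A
  larger admissible m also serves k, since the condition weakens as the bound on the category
  drops.\<close>

lemma cwgtD:
  assumes "enat k \<le> cwgt X u" "0 < k" "closedin X A" "ls_cat X A \<le> enat k"
  shows "is_zero (subtopology X A) (hrestrict X A u)"
proof -
  define P where "P = (\<lambda>k. \<forall>A. closedin X A \<and> ls_cat X A \<le> enat k \<longrightarrow>
     is_zero (subtopology X A) (hrestrict X A u))"
  have "\<exists>m\<ge>k. P m"
  proof (rule ccontr)
    assume "\<not> (\<exists>m\<ge>k. P m)"
    then have "m < k" if "P m" for m
      using that not_le by blast
    then have "x \<le> enat (k - 1)" if "x \<in> {enat k | k. P k}" for x
      using that by fastforce
    then have "cwgt X u \<le> enat (k - 1)"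
      unfolding cwgt_def by (intro Sup_least) (auto simp: P_def)
    then have "enat k \<le> enat (k - 1)"
      using assms(1) by (rule order_trans[rotated])
    then show False
      using assms(2) by simp
  qed
  then obtain m where "k \<le> m" "P m"
    by blast
  moreover have "ls_cat X A \<le> enat m"
    using assms(4) \<open>k \<le> m\<close> by (meson enat_ord_simps(1) order_trans)
  ultimately show ?thesis
    using assms(3) by (simp add: P_def)
qed

context finite_complex
begin

text \<open>The d levels are handed to the factors in I, to each at most as many as its degree, and
  the j removed simplices to the other factors, to each at most as many as its weight. Every factor
  then vanishes on the image of its own open set \<open>S i\<close>.\<close>

lemma seq_product_zero_if_small_remainder:
  fixes X :: "'a topology" and s :: "('a, 'r::comm_ring_1) homogeneous list"
    and w :: "('a, 'r) homogeneous \<Rightarrow> nat"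
  assumes hom: "homeomorphic_map (geometric_realization K) X h" and nonempty: "topspace X \<noteq> {}"
    and carrier: "\<And>u. u \<in> set s \<Longrightarrow> snd u \<in> carrier (cohomology_group (fst u) X)"
    and weight: "\<And>u A. u \<in> set s \<Longrightarrow> closedin X A \<Longrightarrow> ls_cat X A \<le> enat (w u) \<Longrightarrow> vanishes_on X A u"
    and \<tau>: "\<And>l. l < j \<Longrightarrow> \<tau> l \<in> K \<or> \<tau> l = {}"
    and A: "A = \<Union>K - (\<Union>l<j. \<tau> l)"
    and small: "\<And>\<sigma>. \<sigma> \<in> K \<Longrightarrow> \<sigma> \<subseteq> A \<Longrightarrow> card \<sigma> \<le> d"
    and I: "I \<subseteq> {..<length s}"
    and d: "d \<le> (\<Sum>i\<in>I. fst (s ! i))"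
    and j: "j \<le> (\<Sum>i\<in>{..<length s} - I. w (s ! i))"
  shows "is_zero X (seq_product X s)"
proof -
  let ?T = "geometric_realization K"
  have finI: "finite I"
    using I finite_subset by blast
  have finA: "finite A"
    using finite_vertices by (simp add: A)
  obtain g where g: "\<And>c. c < d \<Longrightarrow> g c \<in> I" "\<And>i. i \<in> I \<Longrightarrow> card {c. c < d \<and> g c = i} \<le> fst (s ! i)"
    using ex_allocation[OF finI d] by blast
  obtain f where f: "\<And>l. l < j \<Longrightarrow> f l \<in> {..<length s} - I"
      "\<And>i. i \<in> {..<length s} - I \<Longrightarrow> card {l. l < j \<and> f l = i} \<le> w (s ! i)"
    using ex_allocation[OF _ j] by auto
  define mass where "mass = (\<lambda>l (x :: 'v \<Rightarrow> real). \<Sum>v\<in>\<tau> l. x v)"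
  \<comment> \<open>If all j masses were at most \<open>\<epsilon>\<close>, they would add up to at
    most j/(j+1) < 1.\<close>
  define \<epsilon> where "\<epsilon> = 1 / (real j + 1)"
  have cont: "continuous_map ?T euclideanreal (mass l)" if "l < j" for l
    unfolding mass_def using \<tau>[OF that] simplex_finite
    by (intro continuous_map_sum continuous_map_realization_coord) auto
  have "0 < \<epsilon>"
    by (simp add: \<epsilon>_def)
  have open_gt: "openin ?T {x \<in> points. a < mass l x}" if "l < j" for l a
    using openin_continuous_map_preimage[OF cont[OF that], of "{a<..}"] by simp
  have closed_ge: "closedin ?T {x \<in> points. \<epsilon> \<le> mass l x}" if "l < j" for l
    using closedin_continuous_map_preimage[OF cont[OF that], of "{\<epsilon>..}"] by simp
  \<comment> \<open>An empty \<open>\<tau> l\<close> has mass 0 everywhere, so its star is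
    empty.\<close>
  have cat: "categorical_in ?T {x \<in> points. 0 < mass l x}" if "l < j" for l
  proof (cases "\<tau> l = {}")
    case True
    have "topspace ?T \<noteq> {}"
      using nonempty unfolding homeomorphic_imp_surjective_map[OF hom, symmetric] by blast
    then show ?thesis
      using True categorical_in_empty[of ?T] by (simp add: mass_def)
  next
    case False
    then show ?thesis
      using categorical_in_star \<tau>[OF that] by (auto simp: mass_def)
  qed
  define S where "S = (\<lambda>i. if i \<in> I then \<Union>c\<in>{c. c < d \<and> g c = i}. level A c
      else \<Union>l\<in>{l. l < j \<and> f l = i}. {x \<in> points. \<epsilon> < mass l x})"
  have S_open: "openin ?T (S i)" for i
    using openin_level[OF finA] open_gt by (auto simp: S_def)
  have S_cover: "\<exists>i<length s. x \<in> S i" if x: "x \<in> points" for x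
  proof (cases "\<exists>v\<in>A. 0 < x v")
    case True
    then obtain c where "c < d" "x \<in> level A c"
      using in_level[OF x finA _ _ small] by blast
    then show ?thesis
      using g(1)[of c] I by (intro exI[of _ "g c"]) (auto simp: S_def)
  next
    \<comment> \<open>Without a positive coordinate in A, the total 1 is carried by the removed
      simplices; an overlap among them only increases the sum of their masses.\<close>
    case False
    have nonneg: "0 \<le> x v" for v
      using x by (simp add: points_def)
    have "(\<Union>l<j. \<tau> l) \<subseteq> \<Union>K"
      using \<tau> by blast
    have "1 = (\<Sum>v\<in>\<Union>K. x v)"
      using x by (simp add: points_def)
    also have "\<dots> = (\<Sum>v\<in>(\<Union>l<j. \<tau> l). x v)"
    proof (rule sum.mono_neutral_right)
      show "\<forall>v\<in>\<Union>K - (\<Union>l<j. \<tau> l). x v = 0"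
        using False nonneg by (metis A order.strict_iff_order)
    qed (use finite_vertices \<open>(\<Union>l<j. \<tau> l) \<subseteq> \<Union>K\<close> in simp_all)
    also have "\<dots> \<le> (\<Sum>l<j. mass l x)"
      unfolding mass_def
    proof (rule sum_UN_le)
      show "finite (\<tau> l)" if "l \<in> {..<j}" for l
        using that \<tau>[of l] simplex_finite by auto
    qed (use nonneg in auto)
    finally have "1 \<le> (\<Sum>l<j. mass l x)" .
    then have "\<exists>l<j. \<epsilon> < mass l x"
    proof (rule contrapos_pp)
      assume "\<not> (\<exists>l<j. \<epsilon> < mass l x)"
      then have "(\<Sum>l<j. mass l x) \<le> (\<Sum>l<j. \<epsilon>)"
        by (intro sum_mono) auto
      also have "\<dots> < 1"
        by (simp add: \<epsilon>_def)
      finally show "\<not> 1 \<le> (\<Sum>l<j. mass l x)"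
        by simp
    qed
    then obtain l where "l < j" "\<epsilon> < mass l x"
      by blast
    then show ?thesis
      using f(1)[of l] x by (intro exI[of _ "f l"]) (auto simp: S_def)
  qed
  have S_vanishes: "vanishes_on X (h ` S i) (s ! i)" if i: "i < length s" for i
  proof (cases "i \<in> I")
    case True
    let ?C = "{c. c < d \<and> g c = i}"
    have S: "S i = (\<Union>c\<in>?C. level A c)"
      using True by (simp add: S_def)
    have "cocycles (fst (s ! i)) (subtopology ?T (S i)) \<subseteq>
        (coboundaries (fst (s ! i)) (subtopology ?T (S i)) :: ('v \<Rightarrow> real, 'r) cochain set)"
      unfolding S using g(2)[OF True] finA by (intro cohomology_vanishes_Union_levels) auto
    moreover have "homeomorphic_map (subtopology ?T (S i)) (subtopology X (h ` S i)) h"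
      using openin_subset[OF S_open, of i] homeomorphic_imp_surjective_map[OF hom]
      by (intro homeomorphic_map_subtopologies[OF hom]) (auto simp: Int_absorb1)
    ultimately have "cocycles (fst (s ! i)) (subtopology X (h ` S i)) \<subseteq>
        (coboundaries (fst (s ! i)) (subtopology X (h ` S i)) :: ('a, 'r) cochain set)"
      using cohomology_vanishes_homeomorphic by blast
    then show ?thesis
      using carrier i by (intro vanishes_on_cohomology_vanishes) auto
  next
    case False
    let ?L = "{l. l < j \<and> f l = i}"
    \<comment> \<open>The closed set on which the weight is tested. It contains \<open>S i\<close>,
      and since \<open>\<epsilon>\<close> is positive the open stars of the allotted simplices still
      cover it.\<close>
    define B where "B = (\<Union>l\<in>?L. {x \<in> points. \<epsilon> \<le> mass l x})"
    have B: "closedin ?T B"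
      unfolding B_def using closed_ge by (intro closedin_Union) auto
    have "ls_cat X (h ` B) \<le> enat (card ?L)"
    proof (rule ls_cat_le[where U = "\<lambda>l. h ` (B \<inter> {x \<in> points. 0 < mass l x})"])
      show "h ` B = (\<Union>l\<in>?L. h ` (B \<inter> {x \<in> points. 0 < mass l x}))"
        using \<open>0 < \<epsilon>\<close> by (fastforce simp: B_def)
      fix l
      assume l: "l \<in> ?L"
      have hB: "homeomorphic_map (subtopology ?T B) (subtopology X (h ` B)) h"
        using closedin_subset[OF B] homeomorphic_imp_surjective_map[OF hom]
        by (intro homeomorphic_map_subtopologies[OF hom]) (auto simp: Int_absorb1)
      have "openin (subtopology ?T B) (B \<inter> {x \<in> points. 0 < mass l x})"
        using open_gt[of l 0] l by (auto simp: openin_subtopology_Int2)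
      then show "openin (subtopology X (h ` B)) (h ` (B \<inter> {x \<in> points. 0 < mass l x}))"
        using homeomorphic_map_openness_eq[OF hB] by blast
      have "categorical_in ?T (B \<inter> {x \<in> points. 0 < mass l x})"
        using l by (intro categorical_in_subset[OF cat[of l]]) auto
      then show "categorical_in X (h ` (B \<inter> {x \<in> points. 0 < mass l x}))"
        by (rule categorical_in_homeomorphic_image[OF hom])
    qed simp
    also have "\<dots> \<le> enat (w (s ! i))"
      using f(2)[of i] i False by simp
    finally have "vanishes_on X (h ` B) (s ! i)"
      using i B homeomorphic_map_closedness_eq[OF hom] by (intro weight) auto
    moreover have "S i \<subseteq> B"
      using False by (fastforce simp: S_def B_def)
    ultimately show ?thesis
      by (rule vanishes_on_mono[OF _ image_mono])
  qed
  show ?thesis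
  proof (rule seq_product_zero)
    show "openin X (h ` S i)" if "i < length s" for i
      using S_open homeomorphic_map_openness_eq[OF hom] by blast
    show "topspace X \<subseteq> (\<Union>i<length s. h ` S i)"
      using S_cover homeomorphic_imp_surjective_map[OF hom] by force
  qed (rule S_vanishes)
qed

section \<open>Greedy removal of largest simplices\<close>

lemma ex_max_simplex: "\<exists>\<sigma>. (\<sigma> \<in> K \<or> \<sigma> = {}) \<and> \<sigma> \<subseteq> A \<and> (\<forall>\<rho>\<in>K. \<rho> \<subseteq> A \<longrightarrow> card \<rho> \<le> card \<sigma>)"
proof -
  let ?M = "insert {} {\<sigma> \<in> K. \<sigma> \<subseteq> A}"
  have fin: "finite (card ` ?M)"
    using finite_complex by simp
  have "Max (card ` ?M) \<in> card ` ?M"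
    using fin by (intro Max_in) auto
  then obtain \<sigma> where \<sigma>: "Max (card ` ?M) = card \<sigma>" "\<sigma> \<in> ?M"
    by (rule imageE)
  have "card \<rho> \<le> card \<sigma>" if "\<rho> \<in> K" "\<rho> \<subseteq> A" for \<rho>
    unfolding \<sigma>(1)[symmetric] using fin that by (intro Max_ge) auto
  then show ?thesis
    using \<sigma>(2) by blast
qed

text \<open>The empty set is the value when A contains no simplex, so the removal can always be
  continued.\<close>

definition max_simplex :: "'v set \<Rightarrow> 'v set" where
  "max_simplex A = (SOME \<sigma>. (\<sigma> \<in> K \<or> \<sigma> = {}) \<and> \<sigma> \<subseteq> A \<and> (\<forall>\<rho>\<in>K. \<rho> \<subseteq> A \<longrightarrow> card \<rho> \<le> card \<sigma>))"

lemma max_simplex: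
  "max_simplex A \<in> K \<or> max_simplex A = {}" "max_simplex A \<subseteq> A"
  "\<rho> \<in> K \<Longrightarrow> \<rho> \<subseteq> A \<Longrightarrow> card \<rho> \<le> card (max_simplex A)"
proof -
  have "(max_simplex A \<in> K \<or> max_simplex A = {}) \<and> max_simplex A \<subseteq> A \<and>
      (\<forall>\<rho>\<in>K. \<rho> \<subseteq> A \<longrightarrow> card \<rho> \<le> card (max_simplex A))"
    unfolding max_simplex_def by (rule someI_ex[OF ex_max_simplex])
  then show "max_simplex A \<in> K \<or> max_simplex A = {}" "max_simplex A \<subseteq> A"
      "\<rho> \<in> K \<Longrightarrow> \<rho> \<subseteq> A \<Longrightarrow> card \<rho> \<le> card (max_simplex A)"
    by blast+
qed

primrec remainder :: "nat \<Rightarrow> 'v set" where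
  "remainder 0 = \<Union>K"
| "remainder (Suc l) = remainder l - max_simplex (remainder l)"

lemma remainder_eq: "remainder j = \<Union>K - (\<Union>l<j. max_simplex (remainder l))"
proof (induction j)
  case (Suc j)
  then show ?case
    unfolding remainder.simps lessThan_Suc by blast
qed simp

lemma card_vertices: "card (\<Union>K) = (\<Sum>l<j. card (max_simplex (remainder l))) + card (remainder j)"
proof (induction j)
  case (Suc j)
  have "finite (remainder j)"
    using finite_vertices by (simp add: remainder_eq[of j])
  then have "card (remainder j) = card (max_simplex (remainder j)) + card (remainder (Suc j))"
    using max_simplex(2)[of "remainder j"]
    by (simp add: card_Diff_subset finite_subset card_mono)
  then show ?case
    using Suc by simp
qed simp

end

theorem corollary3p5:
  fixes X :: "'a topology"
    and x0 :: 'a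
    and w :: "('a, 'r::comm_ring_1) homogeneous \<Rightarrow> nat"
    and s :: "('a, 'r) homogeneous list"
  assumes "compact_space X"
    and "path_connected_space X"
    and "triangulable X"
    and "x0 \<in> topspace X"
    and "weight_estimator X x0 w"
    and "set s \<subseteq> reduced_homogeneous X x0"
    and "\<not> is_zero X (seq_product X s)"
  shows "int (min_vertices X) \<ge> wct X w s"
proof -
  \<comment> \<open>The minimum in \<open>min_vertices\<close> is attained only if some
    triangulation has finitely many vertices, which compactness provides.\<close>
  have "\<exists>n. \<exists>K. triangulates K X \<and> finite (\<Union>K) \<and> card (\<Union>K) = n"
  proof -
    obtain K where K: "triangulates K X"
      using assms(3) by (auto simp: triangulable_def)
    then have "compact_space (geometric_realization K)"
      using assms(1) homeomorphic_compact_space by (auto simp: triangulates_def)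
    then show ?thesis
      using K finite_vertices_if_compact by (auto simp: triangulates_def)
  qed
  from LeastI_ex[OF this] obtain K where K: "triangulates K X" "finite (\<Union>K)" "card (\<Union>K) = min_vertices X"
    by (auto simp: min_vertices_def)
  interpret finite_complex K
    using K by unfold_locales (auto simp: triangulates_def)
  obtain h where h: "homeomorphic_map (geometric_realization K) X h"
    using K(1) by (auto simp: triangulates_def homeomorphic_space)
  define W where "W = seq_weight w s"
  have W: "W = (\<Sum>i<length s. w (s ! i))"
    by (simp add: W_def seq_weight_def sum_list_sum_nth atLeast0LessThan)
  have carrier: "snd u \<in> carrier (cohomology_group (fst u) X)" if "u \<in> set s" for u
    using that assms(6) by (auto simp: reduced_homogeneous_def)
  have weight: "vanishes_on X A u" if u: "u \<in> set s" and A: "closedin X A" "ls_cat X A \<le> enat (w u)" for u A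
  proof (cases "is_zero X u")
    case False
    then have "0 < w u" "enat (w u) \<le> cwgt X u"
      using u assms(5,6) by (auto simp: weight_estimator_def)
    then show ?thesis
      using cwgtD[of "w u" X u A] A carrier[OF u] by (intro vanishes_on_hrestrict)
  qed (rule vanishes_on_is_zero)
  \<comment> \<open>If the degree reached d, the j removed simplices and the subsequence I would
    make the product zero, as the factors outside I have weight at least j.\<close>
  have large: "(\<Sum>i\<in>I. fst (s ! i)) < d"
    if "\<And>\<sigma>. \<sigma> \<in> K \<Longrightarrow> \<sigma> \<subseteq> remainder j \<Longrightarrow> card \<sigma> \<le> d" and "I \<subseteq> {..<length s}" "j + (\<Sum>i\<in>I. w (s ! i)) \<le> W" for j d I
  proof (rule ccontr)
    assume "\<not> (\<Sum>i\<in>I. fst (s ! i)) < d"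
    moreover have "j \<le> (\<Sum>i\<in>{..<length s} - I. w (s ! i))"
      using that(3) sum.subset_diff[OF that(2), of "\<lambda>i. w (s ! i)"] by (simp add: W)
    ultimately have "is_zero X (seq_product X s)"
      using that max_simplex(1) carrier weight assms(4)
      by (intro seq_product_zero_if_small_remainder[OF h _ _ _ _ remainder_eq, of s w j d I]) auto
    then show False
      using assms(7) by simp
  qed
  let ?D = "\<lambda>k. {seq_degree X s' | s'. mset s' \<subseteq># mset s \<and> seq_weight w s' \<le> k}"
  have simplex_card: "Max (?D (W - l)) + 1 \<le> int (card (max_simplex (remainder l)))" if l: "l < W" for l
  proof -
    have "?D (W - l) \<subseteq> seq_degree X ` {s'. set s' \<subseteq> set s \<and> length s' \<le> length s}"
      using size_mset_mono set_mset_mono by fastforce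
    then have "finite (?D (W - l))"
      by (rule finite_subset) (simp add: finite_lists_length_le)
    \<comment> \<open>The empty sequence makes the set nonempty, so \<open>Max\<close> is attained
      by some s'.\<close>
    moreover have "seq_degree X ([] :: ('a, 'r) homogeneous list) \<in> ?D (W - l)"
      by (intro CollectI exI[of _ "[]"]) (simp add: seq_weight_def)
    ultimately have "Max (?D (W - l)) \<in> ?D (W - l)"
      by (intro Max_in) auto
    then obtain s' where s': "Max (?D (W - l)) = seq_degree X s'" "mset s' \<subseteq># mset s" "seq_weight w s' \<le> W - l"
      by blast
    show ?thesis
    proof (cases "s' = []")
      case False
      obtain I where I: "I \<subseteq> {..<length s}" "\<And>f :: _ \<Rightarrow> nat. (\<Sum>i\<in>I. f (s ! i)) = sum_list (map f s')"
        using submset_index_set[OF s'(2)] by blast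
      have "(\<Sum>i\<in>I. fst (s ! i)) < card (max_simplex (remainder l))"
        using s'(3) l I by (intro large[of l]) (auto simp: max_simplex(3) seq_weight_def)
      then show ?thesis
        using False I(2)[of fst] unfolding s'(1) by (simp add: seq_degree_def fst_seq_product)
    next
      \<comment> \<open>The degree -1 of the empty sequence makes the required number of vertices
        0.\<close>
      case True
      then show ?thesis
        unfolding s'(1) by (simp add: seq_degree_def)
    qed
  qed
  \<comment> \<open>An empty remainder would allow d = 0 with j = W and I empty, and
    \<open>large\<close> would give 0 < 0.\<close>
  have "remainder W \<noteq> {}"
    using large[of W 0 "{}"] simplex_nonempty by auto
  then have "0 < card (remainder W)"
    using finite_vertices remainder_eq[of W] by (metis card_gt_0_iff finite_Diff)
  \<comment> \<open>The removal with index l, counted from 0, pays for the summand k = W - l of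
    \<open>wct\<close>: larger subsequences are compared with earlier simplices.\<close>
  moreover have "(\<Sum>k=1..W. Max (?D k)) = (\<Sum>l<W. Max (?D (W - l)))"
    by (rule sum.reindex_bij_witness[of _ "\<lambda>l. W - l" "\<lambda>k. W - k"]) auto
  moreover have "(\<Sum>l<W. Max (?D (W - l)) + 1) \<le> (\<Sum>l<W. int (card (max_simplex (remainder l))))"
    using simplex_card by (intro sum_mono) auto
  moreover have "int (min_vertices X) = (\<Sum>l<W. int (card (max_simplex (remainder l)))) + int (card (remainder W))"
    using card_vertices[of W] K(3) by simp
  ultimately show ?thesis
    unfolding wct_def W_def[symmetric] by (simp add: sum.distrib)
qed

end
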